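(* Let $X$ be a Banach space with a (Schauder) basis $(e_n)_{n\in\omega}$, and let $Y$ be a Banach space. Then exactly one of the two following assertions holds: (a) there exists a sequence $I_0<I_1<I_2<\cdots$ of successive subsets of $\omega$ such that for any infinite $J\subset\omega$, $Y$ does not embed isomorphically into $\overline{\mathrm{span}}\,[e_n,\ n\notin\bigcup_{j\in J}I_j]$; (b) there exists a sequence $J_0<J_1<J_2<\cdots$ of successive subsets of $\omega$ such that for any infinite $I\subset\omega$, $Y$ embeds isomorphically into $\overline{\mathrm{span}}\,[e_n,\ n\in\bigcup_{i\in I}J_i]$.
   Context: $\omega=\mathbb{N}=\{0,1,2,\dots\}$. Banach spaces are over the real or complex field (the same for $X$ and $Y$). A sequence $I_0<I_1<I_2<\cdots$ of successive subsets of $\omega$ is a sequence of non-empty finite subsets with $\max I_k<\min I_{k+1}$ for all $k$. "Embeds isomorphically" means that there is a linear isomorphism onto a closed subspace. $\overline{\mathrm{span}}$ denotes closed linear span. *)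

theory Defs
  imports "HOL-Analysis.Analysis"
begin

text \<open>
  Banach spaces over the real or complex field. The scalars range over a type \<open>'k\<close> of sort
  \<open>{real_normed_field, euclidean_space}\<close>: \<open>real\<close> and \<open>complex\<close> are instances, and since a
  finite-dimensional commutative real division algebra with multiplicative norm is isometrically
  isomorphic to one of them, there are no others. The class \<open>banach\<close> supplies the addition, the
  complete norm and the underlying real scalar multiplication of the space.
\<close>

locale banach_space_over = vector_space smul
  for smul :: "'k::{real_normed_field, euclidean_space} \<Rightarrow> 'a::banach \<Rightarrow> 'a" +
  assumes smul_of_real: "smul (of_real r) x = r *\<^sub>R x"
    and norm_smul: "norm (smul c x) = norm c * norm x"

definition schauder_basis ::
  "('k::{real_normed_field, euclidean_space} \<Rightarrow> 'a::banach \<Rightarrow> 'a) \<Rightarrow> (nat \<Rightarrow> 'a) \<Rightarrow> bool" where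
  "schauder_basis smul e \<longleftrightarrow> (\<forall>x. \<exists>!a. (\<lambda>n. smul (a n) (e n)) sums x)"

definition closed_span ::
  "('k::{real_normed_field, euclidean_space} \<Rightarrow> 'a::banach \<Rightarrow> 'a) \<Rightarrow> 'a set \<Rightarrow> 'a set" where
  "closed_span smul A = closure (module.span smul A)"

text \<open>
  A linear isomorphism of Banach spaces is a linear homeomorphism. The whole type \<open>'b\<close> is embedded
  into the subset \<open>Z\<close> of \<open>'a\<close>.
\<close>

definition embeds_isomorphically ::
  "('k::{real_normed_field, euclidean_space} \<Rightarrow> 'b::banach \<Rightarrow> 'b) \<Rightarrow> ('k \<Rightarrow> 'a::banach \<Rightarrow> 'a) \<Rightarrow>
    'a set \<Rightarrow> bool" where
  "embeds_isomorphically scaleY scaleX Z \<longleftrightarrow>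
    (\<exists>T. Vector_Spaces.linear scaleY scaleX T \<and> range T \<subseteq> Z \<and> closed (range T) \<and>
      (\<exists>S. homeomorphism UNIV (range T) T S))"

definition successive :: "(nat \<Rightarrow> nat set) \<Rightarrow> bool" where
  "successive I \<longleftrightarrow>
    (\<forall>k. finite (I k) \<and> I k \<noteq> {}) \<and> (\<forall>k. Max (I k) < Min (I (Suc k)))"

end

theory Submission
  imports Defs
begin

text \<open>
  Let \<open>E\<close> be the family of all \<open>u \<subseteq> \<nat>\<close> such that \<open>Y\<close> embeds into the closed span of
  \<open>{e n | n. n \<in> u}\<close>; it is closed under supersets. For such a family, being meagre in the Cantor
  space amounts to alternative (a) and being comeagre to alternative (b). The two are therefore
  incompatible, and the content is a zero-one law: \<open>E\<close> is meagre or comeagre. The reasons are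
  that \<open>E\<close> is analytic, so that it has the Baire property, and that it is invariant under
  exchanging finitely many elements, so that it cannot be comeagre in one open set and meagre in
  another one.

  The argument below is combinatorial and works with bounds on gaps instead of topology. A family
  is \<open>small\<close> if a single function \<open>h\<close> forces every member to meet \<open>{n..<h n}\<close> for almost all
  \<open>n\<close>. The small families form a \<open>\<sigma>\<close>-ideal, and smallness of \<open>E\<close> yields (a)
  (\<open>small_imp_successive\<close>). So let \<open>E\<close> not be small.

  Analyticity enters through a coding of embeddings. If \<open>E\<close> has a member, then \<open>Y\<close> is separable,
  and an embedding of \<open>Y\<close> is described by a bound \<open>K\<close> for it and its inverse, together with
  vectors from a fixed countable set which approximate the images of the terms of a dense sequence
  (\<open>embeds_imp_code\<close>, \<open>code_imp_embeds\<close>). The set of codes is closed, and \<open>u \<in> E\<close> iff all entries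
  of some code have their support in \<open>u\<close>. For a finite initial segment \<open>\<sigma>\<close> of codes and a set
  \<open>s\<close>, call \<open>(s, \<sigma>)\<close> persistent if, for every \<open>n\<close>, the family of those \<open>u\<close> for which \<open>s\<close> joined
  with the part of \<open>u\<close> beyond \<open>n\<close> supports a code extending \<open>\<sigma>\<close> is not small. The
  \<open>\<sigma>\<close>-ideal property shows that, beyond any \<open>n\<close>, adding a long enough interval to \<open>s\<close> makes some
  one-step extension of \<open>\<sigma>\<close> persistent (\<open>persistent_extend\<close>). Choosing successive intervals
  \<open>J k\<close> that serve all of the finitely many pairs met so far gives sets as in (b): a set
  that contains infinitely many of the \<open>J k\<close> allows infinitely many extension steps, hence supports
  a code (\<open>persistent_imp_successive\<close>).

  The start of this construction, persistence of the empty pair, is where the exchange property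
  enters. If \<open>p \<in> u\<close> and \<open>q \<notin> u\<close>, then \<open>x \<mapsto> x - coord x p (e p - e q)\<close> is an isomorphism from the
  closed span over \<open>u\<close> onto the closed span over \<open>insert q (u - {p})\<close> (\<open>embeds_swap\<close>), so the
  elements of \<open>u\<close> below \<open>n\<close> can be moved beyond \<open>n\<close>. This needs continuity of the coordinate
  functionals, which is derived from the Baire category theorem (\<open>partial_sum_bounded\<close>).
\<close>

section \<open>Small families and successive sets\<close>

text \<open>
  For families closed under supersets this is meagreness in the Cantor space: the next-element
  functions of the members are eventually dominated by one function.
\<close>

definition small :: "nat set set \<Rightarrow> bool" where
  "small E \<longleftrightarrow> (\<exists>h. \<forall>u\<in>E. \<forall>\<^sub>F n in sequentially. u \<inter> {n..<h n} \<noteq> {})"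

lemma small_subset: "small E \<Longrightarrow> F \<subseteq> E \<Longrightarrow> small F"
  unfolding small_def by blast

text \<open>
  A diagonal bound works: from index \<open>k\<close> on, \<open>H\<close> dominates the bound for the \<open>k\<close>-th family.
\<close>

lemma small_UN:
  fixes E :: "nat \<Rightarrow> nat set set"
  assumes "\<And>k. small (E k)"
  shows "small (\<Union>k. E k)"
proof -
  obtain h where h: "\<And>k u. u \<in> E k \<Longrightarrow> \<forall>\<^sub>F n in sequentially. u \<inter> {n..<h k n} \<noteq> {}"
    using assms unfolding small_def by metis
  define H where "H n = Max ((\<lambda>k. h k n) ` {..n})" for n
  have "\<forall>\<^sub>F n in sequentially. u \<inter> {n..<H n} \<noteq> {}" if "u \<in> E k" for u k
    using h[OF that] eventually_ge_at_top[of k]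
  proof eventually_elim
    case (elim n)
    then have "h k n \<le> H n"
      unfolding H_def by (intro Max_ge) auto
    then have "{n..<h k n} \<subseteq> {n..<H n}"
      by auto
    with elim show ?case by blast
  qed
  then show ?thesis
    unfolding small_def by blast
qed

lemma small_countable_UN:
  assumes "countable C" "\<And>c. c \<in> C \<Longrightarrow> small (E c)"
  shows "small (\<Union>c\<in>C. E c)"
proof (cases "C = {}")
  case True
  then show ?thesis by (simp add: small_def)
next
  case False
  have "small (\<Union>k. E (from_nat_into C k))"
    using assms False by (intro small_UN) (simp add: from_nat_into)
  also have "(\<Union>k. E (from_nat_into C k)) = (\<Union>c\<in>C. E c)"
    using range_from_nat_into[OF False assms(1)] by (metis image_image)
  finally show ?thesis .
qed

lemma small_Un: "small E \<Longrightarrow> small F \<Longrightarrow> small (E \<union> F)"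
  by (rule small_subset[OF small_UN[of "\<lambda>k::nat. if k = 0 then E else F"]]) auto

lemma successive_intervals:
  assumes "\<And>k. g k < g (Suc k)"
  shows "successive (\<lambda>k. {g k..<g (Suc k)})"
  unfolding successive_def
proof (intro conjI allI)
  fix k
  have "Max {g k..<g (Suc k)} \<in> {g k..<g (Suc k)}"
    using assms by (intro Max_in) auto
  moreover have "Min {g (Suc k)..<g (Suc (Suc k))} \<in> {g (Suc k)..<g (Suc (Suc k))}"
    using assms by (intro Min_in) auto
  ultimately show "Max {g k..<g (Suc k)} < Min {g (Suc k)..<g (Suc (Suc k))}"
    by simp
qed (use assms in auto)

text \<open>
  Iterating the bound \<open>h\<close> cuts the natural numbers into intervals, almost all of which meet a given
  member.
\<close>

lemma small_imp_successive:
  assumes "small E"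
  obtains I where "successive I" "\<And>u. u \<in> E \<Longrightarrow> \<forall>\<^sub>F k in sequentially. u \<inter> I k \<noteq> {}"
proof -
  obtain h where h: "\<And>u. u \<in> E \<Longrightarrow> \<forall>\<^sub>F n in sequentially. u \<inter> {n..<h n} \<noteq> {}"
    using assms unfolding small_def by blast
  define g where "g = rec_nat 0 (\<lambda>_ n. max (Suc n) (h n))"
  have g: "g (Suc k) = max (Suc (g k)) (h (g k))" for k
    by (simp add: g_def)
  have gmono: "strict_mono g"
    by (rule strict_monoI_Suc) (simp add: g)
  have gle: "g k < g (Suc k)" for k by (simp add: g)
  show ?thesis
  proof
    show "successive (\<lambda>k. {g k..<g (Suc k)})"
      using gle by (rule successive_intervals)
    fix u assume "u \<in> E"
    from h[OF this] have "\<forall>\<^sub>F k in sequentially. u \<inter> {g k..<h (g k)} \<noteq> {}"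
      using filterlim_subseq[OF gmono] by (rule eventually_compose_filterlim)
    then show "\<forall>\<^sub>F k in sequentially. u \<inter> {g k..<g (Suc k)} \<noteq> {}"
    proof eventually_elim
      case (elim k)
      have "{g k..<h (g k)} \<subseteq> {g k..<g (Suc k)}"
        by (auto simp: g)
      with elim show ?case by blast
    qed
  qed
qed

lemma successive_less:
  assumes "successive I" "i < j" "x \<in> I i" "y \<in> I j"
  shows "x < y"
proof -
  have fin: "finite (I k)" "I k \<noteq> {}" for k
    using assms(1) by (auto simp: successive_def)
  have "Max (I i) < Min (I j)"
    using \<open>i < j\<close>
  proof (induction j rule: less_Suc_induct)
    case (1 i)
    then show ?case using assms(1) by (auto simp: successive_def)
  next
    case (2 i j k)
    have "Min (I j) \<le> Max (I j)" using fin by simp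
    with 2 show ?case by linarith
  qed
  moreover have "x \<le> Max (I i)" "Min (I j) \<le> y"
    using fin assms by auto
  ultimately show ?thesis by linarith
qed

lemma successive_ge:
  assumes "successive I" "x \<in> I k"
  shows "k \<le> x"
  using assms(2)
proof (induction k arbitrary: x)
  case (Suc k)
  obtain y where "y \<in> I k" using assms(1) by (auto simp: successive_def)
  with Suc.IH successive_less[OF assms(1) lessI this Suc.prems] show ?case
    by fastforce
qed simp

text \<open>
  This is what makes the two alternatives exclude each other: blocks of the two sequences can
  be picked alternately, each one beyond the block picked before it.
\<close>

lemma successive_disjoint_subsequences:
  assumes "successive I" "successive J"
  obtains A B where "infinite A" "infinite B" "(\<Union>k\<in>A. I k) \<inter> (\<Union>k\<in>B. J k) = {}"
proof -
  have finI: "finite (I k)" "I k \<noteq> {}" and finJ: "finite (J k)" "J k \<noteq> {}" for k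
    using assms by (auto simp: successive_def)
  (* Since I k and J k lie in {k..}, the block I (a n) lies beyond J n, and J (g (Suc m)) lies
     beyond I (a (g m)). *)
  define a where "a n = Suc (Max (J n))" for n
  define g where "g = rec_nat 0 (\<lambda>_ n. Suc (Max (I (a n))))"
  have g: "g (Suc m) = Suc (Max (I (a (g m))))" for m
    by (simp add: g_def)
  have up: "x < y" if "x \<in> J n" "y \<in> I (a n)" for x y n
  proof -
    have "x \<le> Max (J n)" using finJ that by simp
    also have "\<dots> < a n" by (simp add: a_def)
    also have "a n \<le> y" using successive_ge assms(1) that by blast
    finally show ?thesis .
  qed
  have down: "x < y" if "x \<in> I (a (g m))" "y \<in> J (g (Suc m))" for x y m
  proof -
    have "x \<le> Max (I (a (g m)))" using finI that by simp
    also have "\<dots> < g (Suc m)" by (simp add: g)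
    also have "\<dots> \<le> y" using successive_ge assms(2) that by blast
    finally show ?thesis .
  qed
  have step: "g m < g (Suc m)" for m
  proof -
    obtain x y where "x \<in> J (g m)" "y \<in> I (a (g m))" using finI finJ by blast
    moreover from this have "x < y" "g m \<le> x"
      using up successive_ge assms(2) by blast+
    moreover have "y \<le> Max (I (a (g m)))" using finI calculation by simp
    ultimately show ?thesis by (simp add: g)
  qed
  have gmono: "strict_mono g"
    using step by (rule strict_monoI_Suc)
  have amono: "a i < a j" if "i < j" for i j
    unfolding a_def using successive_less[OF assms(2) that, of "Max (J i)" "Max (J j)"] finJ
    by simp
  have "strict_mono (a \<circ> g)"
    using gmono amono by (simp add: strict_mono_def)
  then have "infinite (range (a \<circ> g))" "infinite (range g)"
    using gmono by (simp_all only: strict_mono_imp_inj_on range_inj_infinite not_False_eq_True)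
  moreover have "(\<Union>k\<in>range (a \<circ> g). I k) \<inter> (\<Union>k\<in>range g. J k) = {}"
  proof -
    have False if x: "x \<in> I (a (g m))" "x \<in> J (g n)" for x m n
    proof (cases "n \<le> m")
      case True
      obtain z where z: "z \<in> J (g m)" using finJ by blast
      have "x \<le> z \<or> n = m"
        using True successive_less[OF assms(2) _ x(2) z] gmono
        by (metis le_neq_implies_less less_imp_le strict_mono_less)
      with up[OF z x(1)] up[of x "g m" x] x show False by auto
    next
      case False
      obtain z where z: "z \<in> J (g (Suc m))" using finJ by blast
      have "z \<le> x \<or> n = Suc m"
        using False successive_less[OF assms(2) _ z x(2)] gmono
        by (metis Suc_leI le_neq_implies_less less_imp_le not_le strict_mono_less)
      with down[OF x(1) z] down[OF x(1), of x] x show False by auto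
    qed
    then show ?thesis by auto
  qed
  ultimately show ?thesis using that by blast
qed

section \<open>Analytic families that are not small\<close>

text \<open>
  With \<open>\<sigma> = []\<close>, \<open>G\<close> closed and countably many possible entries, this is the general form of an analytic
  family closed under supersets: \<open>u\<close> belongs to it iff some branch in \<open>G\<close> has all its supports inside \<open>u\<close>. The other values of \<open>\<sigma>\<close>
  are the pieces of the corresponding Souslin scheme.
\<close>

definition cyl :: "(nat \<Rightarrow> 'c) set \<Rightarrow> ('c \<Rightarrow> nat set) \<Rightarrow> 'c list \<Rightarrow> nat set set" where
  "cyl G supp \<sigma> = {u. \<exists>f\<in>G. map f [0..<length \<sigma>] = \<sigma> \<and> (\<forall>i. supp (f i) \<subseteq> u)}"

lemma cyl_mono: "u \<in> cyl G supp \<sigma> \<Longrightarrow> u \<subseteq> v \<Longrightarrow> v \<in> cyl G supp \<sigma>"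
  unfolding cyl_def by blast

lemma cyl_split:
  assumes "\<And>f i. f \<in> G \<Longrightarrow> f i \<in> C"
  shows "cyl G supp \<sigma> = (\<Union>c\<in>C. cyl G supp (\<sigma> @ [c]))"
proof (intro equalityI subsetI)
  fix u assume "u \<in> cyl G supp \<sigma>"
  then obtain f where f: "f \<in> G" "map f [0..<length \<sigma>] = \<sigma>" "\<forall>i. supp (f i) \<subseteq> u"
    by (auto simp: cyl_def)
  then have "u \<in> cyl G supp (\<sigma> @ [f (length \<sigma>)])"
    unfolding cyl_def by auto
  with assms f(1) show "u \<in> (\<Union>c\<in>C. cyl G supp (\<sigma> @ [c]))" by blast
qed (auto simp: cyl_def)

text \<open>
  Topologically, for \<open>s \<subseteq> {..<n}\<close>, \<open>cyl G supp \<sigma>\<close> is nonmeagre in every nonempty open subset of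
  \<open>{u. u \<inter> {..<n} = s}\<close>. Because \<open>cyl G supp \<sigma>\<close> is closed under supersets, the worst basic open
  subsets are those which add no element to \<open>s\<close>, so that the condition refers to \<open>s\<close> alone and
  survives an enlargement of \<open>s\<close>.
\<close>

definition persistent :: "(nat \<Rightarrow> 'c) set \<Rightarrow> ('c \<Rightarrow> nat set) \<Rightarrow> nat set \<times> 'c list \<Rightarrow> bool" where
  "persistent G supp = (\<lambda>(s, \<sigma>). \<forall>n. \<not> small {u. s \<union> (u \<inter> {n..}) \<in> cyl G supp \<sigma>})"

lemma persistent_mono:
  assumes "persistent G supp (s, \<sigma>)" "s \<subseteq> t"
  shows "persistent G supp (t, \<sigma>)"
  unfolding persistent_def case_prod_conv
proof
  fix n
  have "{u. s \<union> (u \<inter> {n..}) \<in> cyl G supp \<sigma>} \<subseteq> {u. t \<union> (u \<inter> {n..}) \<in> cyl G supp \<sigma>}"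
    using assms(2) by (auto elim!: cyl_mono)
  then show "\<not> small {u. t \<union> (u \<inter> {n..}) \<in> cyl G supp \<sigma>}"
    using small_subset assms(1) unfolding persistent_def case_prod_conv by metis
qed

text \<open>
  Otherwise, for every \<open>c\<close>, each pair \<open>(s \<union> {n..<k}, \<sigma> @ [c])\<close> fails to be persistent, as witnessed by
  smallness beyond some \<open>m k\<close>. A set \<open>u\<close> for which \<open>s\<close> and the part of \<open>u\<close> beyond \<open>n\<close> support an
  extension of \<open>\<sigma> @ [c]\<close> either meets almost all intervals \<open>{k..<m k}\<close>, which is a small condition, or misses
  one of them. In the latter case filling up \<open>{n..<k}\<close> puts it into the small family witnessing failure at
  \<open>k\<close>. A countable union over \<open>c\<close> then contradicts persistence of \<open>(s, \<sigma>)\<close>.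
\<close>

lemma persistent_extend:
  assumes C: "countable C" "\<And>f i. f \<in> G \<Longrightarrow> f i \<in> C"
    and pers: "persistent G supp (s, \<sigma>)"
  shows "\<exists>n'\<ge>n. \<exists>c. persistent G supp (s \<union> {n..<n'}, \<sigma> @ [c])"
proof (rule ccontr)
  assume neg: "\<not> ?thesis"
  have "small {u. s \<union> (u \<inter> {n..}) \<in> cyl G supp (\<sigma> @ [c])}" for c
  proof -
    define S where "S = (\<lambda>k m. {u. (s \<union> {n..<k}) \<union> (u \<inter> {m..}) \<in> cyl G supp (\<sigma> @ [c])})"
    have "\<exists>m. small (S k m)" if "n \<le> k" for k
      using neg that by (auto simp: persistent_def S_def)
    then obtain m where m: "\<And>k. n \<le> k \<Longrightarrow> small (S k (m k))"
      by metis
    define R where "R = {u. \<forall>\<^sub>F k in sequentially. u \<inter> {k..<m k} \<noteq> {}}"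
    have "small R"
      unfolding small_def R_def by blast
    moreover have "small (\<Union>k\<in>{n..}. S k (m k))"
      using m by (intro small_countable_UN) auto
    moreover have "{u. s \<union> (u \<inter> {n..}) \<in> cyl G supp (\<sigma> @ [c])} \<subseteq> R \<union> (\<Union>k\<in>{n..}. S k (m k))"
    proof
      fix u assume u: "u \<in> {u. s \<union> (u \<inter> {n..}) \<in> cyl G supp (\<sigma> @ [c])}"
      show "u \<in> R \<union> (\<Union>k\<in>{n..}. S k (m k))"
      proof (cases "\<exists>k\<ge>n. u \<inter> {k..<m k} = {}")
        case True
        then obtain k where k: "n \<le> k" "u \<inter> {k..<m k} = {}" by blast
        have "x \<in> {n..<k} \<union> (u \<inter> {m k..})" if "x \<in> u \<inter> {n..}" for x
        proof -
          from that k(2) have "\<not> (k \<le> x \<and> x < m k)" by auto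
          with that show ?thesis by auto
        qed
        then have "s \<union> (u \<inter> {n..}) \<subseteq> (s \<union> {n..<k}) \<union> (u \<inter> {m k..})"
          by blast
        with u have "u \<in> S k (m k)"
          unfolding S_def by (auto elim: cyl_mono)
        with k show ?thesis by auto
      next
        case False
        then show ?thesis
          unfolding R_def eventually_sequentially by blast
      qed
    qed
    ultimately show ?thesis
      using small_Un small_subset by blast
  qed
  then have "small (\<Union>c\<in>C. {u. s \<union> (u \<inter> {n..}) \<in> cyl G supp (\<sigma> @ [c])})"
    using C(1) by (intro small_countable_UN)
  moreover have "{u. s \<union> (u \<inter> {n..}) \<in> cyl G supp \<sigma>} \<subseteq>
      (\<Union>c\<in>C. {u. s \<union> (u \<inter> {n..}) \<in> cyl G supp (\<sigma> @ [c])})"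
    using cyl_split[of G C supp \<sigma>] C(2) by blast
  ultimately have "small {u. s \<union> (u \<inter> {n..}) \<in> cyl G supp \<sigma>}"
    using small_subset by blast
  with pers show False by (auto simp: persistent_def)
qed

text \<open>
  The second part uses persistence for arbitrarily large \<open>n\<close>: an element of \<open>supp (f i)\<close> cannot be
  supplied by the part of \<open>u\<close> beyond it.
\<close>

lemma persistent_supp_subset:
  assumes "persistent G supp (s, map f [0..<m])"
  shows "\<exists>g\<in>G. \<forall>i<m. g i = f i" "i < m \<Longrightarrow> supp (f i) \<subseteq> s"
proof -
  have *: "\<exists>u. s \<union> (u \<inter> {n..}) \<in> cyl G supp (map f [0..<m])" for n
  proof (rule ccontr)
    assume "\<not> ?thesis"
    then have "{u. s \<union> (u \<inter> {n..}) \<in> cyl G supp (map f [0..<m])} = {}" by blast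
    then have "small {u. s \<union> (u \<inter> {n..}) \<in> cyl G supp (map f [0..<m])}"
      by (simp add: small_def)
    with assms show False by (simp add: persistent_def)
  qed
  show "\<exists>g\<in>G. \<forall>i<m. g i = f i"
    using *[of 0] by (auto simp: cyl_def Ball_def)
  show "supp (f i) \<subseteq> s" if "i < m"
  proof
    fix x assume "x \<in> supp (f i)"
    moreover obtain u g where "\<forall>i<m. g i = f i" "\<forall>i. supp (g i) \<subseteq> s \<union> (u \<inter> {Suc x..})"
      using *[of "Suc x"] unfolding cyl_def by (auto simp: atLeast0LessThan)
    ultimately have "x \<in> s \<union> (u \<inter> {Suc x..})" using that by (metis subsetD)
    then show "x \<in> s" by auto
  qed
qed

text \<open>
  The intervals are chosen so that \<open>J k\<close> permits an extension step simultaneously for all pairs that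
  arise from the empty one by steps along a subset of \<open>{J 0, ..., J (k - 1)}\<close>. There are finitely many
  such pairs. For an infinite \<open>I\<close>, the steps along the \<open>J k\<close> with \<open>k \<in> I\<close> then produce a branch whose
  initial segments are all persistent, and closedness of \<open>G\<close> puts the branch into \<open>G\<close>.
\<close>

theorem persistent_imp_successive:
  fixes G :: "(nat \<Rightarrow> 'c) set"
  assumes C: "countable C" "\<And>f i. f \<in> G \<Longrightarrow> f i \<in> C"
    and closed: "\<And>f. (\<And>m. \<exists>g\<in>G. \<forall>i<m. g i = f i) \<Longrightarrow> f \<in> G"
    and pers: "persistent G supp ({}, [])"
  obtains J where "successive J"
    "\<And>I. infinite I \<Longrightarrow> (\<Union>k\<in>I. J k) \<in> cyl G supp []"
proof -
  let ?P = "persistent G supp"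
  have "\<forall>p n. \<exists>c n'. ?P p \<longrightarrow> n < n' \<and> (\<forall>k\<ge>n'. ?P (fst p \<union> {n..<k}, snd p @ [c]))"
  proof (intro allI)
    fix p :: "nat set \<times> 'c list" and n
    show "\<exists>c n'. ?P p \<longrightarrow> n < n' \<and> (\<forall>k\<ge>n'. ?P (fst p \<union> {n..<k}, snd p @ [c]))"
    proof (cases "?P p")
      case True
      then have "?P (fst p, snd p)"
        by simp
      then obtain n' c where n': "n \<le> n'" "?P (fst p \<union> {n..<n'}, snd p @ [c])"
        using persistent_extend[OF C(1), of G] C(2) by metis
      have "?P (fst p \<union> {n..<k}, snd p @ [c])" if "Suc n' \<le> k" for k
        using that by (intro persistent_mono[OF n'(2)]) auto
      with n' show ?thesis by (intro exI[of _ c] exI[of _ "Suc n'"]) auto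
    qed blast
  qed
  then obtain c N where cN: "\<And>p n. ?P p \<Longrightarrow> n < N p n"
    "\<And>p n k. ?P p \<Longrightarrow> N p n \<le> k \<Longrightarrow> ?P (fst p \<union> {n..<k}, snd p @ [c p n])"
    by metis
  (* stage k = (g k, St k): St k holds every pair that can be reached by the first k intervals,
     where each interval {g i..<g (Suc i)} is either skipped or used for an extension step. *)
  define ext where "ext n k p = (fst p \<union> {n..<k}, snd p @ [c p n])" for n k p
  define next_end where "next_end n S = Max ((\<lambda>p. N p n) ` S)" for n S
  define stage where "stage = rec_nat (0, {({}, [])})
    (\<lambda>_ (n, S). (next_end n S, S \<union> ext n (next_end n S) ` S))"
  define g where "g = fst \<circ> stage"
  define St where "St = snd \<circ> stage"
  have g0: "g 0 = 0" "St 0 = {({}, [])}"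
    by (auto simp: g_def St_def stage_def)
  have gS: "g (Suc k) = next_end (g k) (St k)"
    "St (Suc k) = St k \<union> ext (g k) (g (Suc k)) ` St k" for k
    by (auto simp: g_def St_def stage_def split: prod.splits)
  have fin: "finite (St k)" and ne: "({}, []) \<in> St k" for k
    by (induction k) (auto simp: g0 gS)
  have Nle: "N p (g k) \<le> g (Suc k)" if "p \<in> St k" for p k
    unfolding gS(1) next_end_def using that fin by (intro Max_ge) auto
  have PSt: "?P p" if "p \<in> St k" for p k
    using that
  proof (induction k arbitrary: p)
    case 0
    then show ?case using pers by (simp add: g0)
  next
    case (Suc k)
    then consider "p \<in> St k" | q where "q \<in> St k" "p = ext (g k) (g (Suc k)) q"
      unfolding gS(2) by blast
    then show ?case
      using Suc.IH cN(2) Nle unfolding ext_def by cases auto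
  qed
  have gstep: "g k < g (Suc k)" for k
    using cN(1)[OF PSt[OF ne[of k]], of "g k"] Nle[OF ne, of k] by linarith
  have Stmono: "St i \<subseteq> St j" if "i \<le> j" for i j
    using that by (rule lift_Suc_mono_le[rotated]) (auto simp: gS)
  define J where "J k = {g k..<g (Suc k)}" for k
  show ?thesis
  proof
    show "successive J"
      unfolding J_def using gstep by (rule successive_intervals)
  next
    fix I :: "nat set" assume I: "infinite I"
    (* r m is the pair reached after m steps; the steps use exactly the intervals with index in I. *)
    define i where "i = enumerate I"
    define r where "r = rec_nat ({}, []) (\<lambda>m p. ext (g (i m)) (g (Suc (i m))) p)"
    have r0: "r 0 = ({}, [])" and rS: "r (Suc m) = ext (g (i m)) (g (Suc (i m))) (r m)" for m
      by (auto simp: r_def)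
    have rSt: "r m \<in> St (i m)" for m
    proof (induction m)
      case (Suc m)
      then have "r (Suc m) \<in> St (Suc (i m))"
        unfolding rS gS(2) by blast
      moreover have "Suc (i m) \<le> i (Suc m)"
        unfolding i_def using I by (simp add: enumerate_step Suc_leI)
      ultimately show ?case using Stmono by blast
    qed (simp add: r0 ne)
    define f where "f m = c (r m) (g (i m))" for m
    have sr: "snd (r m) = map f [0..<m]" for m
      by (induction m) (auto simp: r0 rS ext_def f_def)
    have fr: "fst (r m) \<subseteq> (\<Union>k\<in>I. J k)" for m
    proof (induction m)
      case (Suc m)
      have "i m \<in> I" unfolding i_def using I by (rule enumerate_in_set)
      with Suc show ?case by (auto simp: rS ext_def J_def)
    qed (simp add: r0)
    have pr: "?P (fst (r m), map f [0..<m])" for m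
      using PSt[OF rSt[of m]] by (simp flip: sr)
    have "f \<in> G"
      using persistent_supp_subset(1)[OF pr] by (rule closed)
    moreover have "supp (f k) \<subseteq> (\<Union>k\<in>I. J k)" for k
      using persistent_supp_subset(2)[OF pr lessI] fr by blast
    ultimately show "(\<Union>k\<in>I. J k) \<in> cyl G supp []"
      unfolding cyl_def by auto
  qed
qed

section \<open>Continuity of the coordinate functionals of a Schauder basis\<close>

context banach_space_over
begin

lemma bounded_linear_smul_right: "bounded_linear (smul c)"
proof (rule bounded_linear_intro)
  show "smul c (r *\<^sub>R x) = r *\<^sub>R smul c x" for r x
    by (simp add: mult.commute flip: smul_of_real)
  show "norm (smul c x) \<le> norm x * norm c" for x
    by (simp add: norm_smul)
qed (rule scale_right_distrib)

lemma bounded_linear_smul_left: "bounded_linear (\<lambda>c. smul c x)"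
proof (rule bounded_linear_intro)
  show "smul (r *\<^sub>R c) x = r *\<^sub>R smul c x" for r c
    by (simp add: scaleR_conv_of_real flip: smul_of_real)
  show "norm (smul c x) \<le> norm c * norm x" for c
    by (simp add: norm_smul)
qed (rule scale_left_distrib)

lemmas tendsto_smul_left = bounded_linear.tendsto[OF bounded_linear_smul_left]
lemmas tendsto_smul_right = bounded_linear.tendsto[OF bounded_linear_smul_right]

end

locale schauder_space = banach_space_over smul
  for smul :: "'k::{real_normed_field, euclidean_space} \<Rightarrow> 'a::banach \<Rightarrow> 'a" +
  fixes e :: "nat \<Rightarrow> 'a"
  assumes basis: "schauder_basis smul e"
begin

definition coord :: "'a \<Rightarrow> nat \<Rightarrow> 'k" where
  "coord x = (THE a. (\<lambda>n. smul (a n) (e n)) sums x)"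

lemma sums_coord: "(\<lambda>n. smul (coord x n) (e n)) sums x"
  using basis theI'[of "\<lambda>a. (\<lambda>n. smul (a n) (e n)) sums x"]
  unfolding schauder_basis_def coord_def by blast

lemma coord_eqI: "(\<lambda>n. smul (a n) (e n)) sums x \<Longrightarrow> coord x = a"
  using basis sums_coord unfolding schauder_basis_def by blast

lemma coord_add: "coord (x + y) = (\<lambda>n. coord x n + coord y n)"
  by (rule coord_eqI) (simp add: scale_left_distrib sums_add sums_coord)

lemma coord_diff: "coord (x - y) = (\<lambda>n. coord x n - coord y n)"
  by (rule coord_eqI) (simp add: scale_left_diff_distrib sums_diff sums_coord)

lemma coord_smul: "coord (smul c x) = (\<lambda>n. c * coord x n)"
  using bounded_linear.sums[OF bounded_linear_smul_right sums_coord]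
  by (intro coord_eqI) simp

lemma coord_zero: "coord 0 = (\<lambda>n. 0)"
  by (rule coord_eqI) simp

lemma coord_finite_sum:
  assumes "finite A"
  shows "coord (\<Sum>n\<in>A. smul (c n) (e n)) = (\<lambda>n. if n \<in> A then c n else 0)"
proof (rule coord_eqI)
  have "(\<lambda>n. if n \<in> A then smul (c n) (e n) else 0) sums (\<Sum>n\<in>A. smul (c n) (e n))"
    using assms by (rule sums_If_finite_set)
  then show "(\<lambda>n. smul (if n \<in> A then c n else 0) (e n)) sums (\<Sum>n\<in>A. smul (c n) (e n))"
    by (rule sums_cong[THEN iffD1, rotated]) simp
qed

lemma coord_basis: "coord (e n) = (\<lambda>k. if k = n then 1 else 0)"
  using coord_finite_sum[of "{n}" "\<lambda>_. 1"] by simp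

lemma basis_nonzero: "e n \<noteq> 0"
  using coord_basis[of n] coord_zero by (metis one_neq_zero)

definition partial_sum :: "nat \<Rightarrow> 'a \<Rightarrow> 'a" where
  "partial_sum n x = (\<Sum>k<n. smul (coord x k) (e k))"

lemma partial_sum_tendsto: "(\<lambda>n. partial_sum n x) \<longlonglongrightarrow> x"
  using sums_coord by (simp add: sums_def partial_sum_def)

lemma partial_sum_add: "partial_sum n (x + y) = partial_sum n x + partial_sum n y"
  by (simp add: partial_sum_def coord_add scale_left_distrib sum.distrib)

lemma partial_sum_diff: "partial_sum n (x - y) = partial_sum n x - partial_sum n y"
  by (simp add: partial_sum_def coord_diff scale_left_diff_distrib sum_subtractf)

lemma partial_sum_scaleR: "partial_sum n (r *\<^sub>R x) = r *\<^sub>R partial_sum n x"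
  by (simp add: partial_sum_def coord_smul scale_sum_right flip: smul_of_real)

lemma partial_sum_Suc: "partial_sum (Suc n) x = partial_sum n x + smul (coord x n) (e n)"
  by (simp add: partial_sum_def)

lemma norm_coord_le:
  assumes "\<And>n. norm (partial_sum n x) \<le> B"
  shows "norm (coord x n) * norm (e n) \<le> 2 * B"
proof -
  have "norm (coord x n) * norm (e n) = norm (partial_sum (Suc n) x - partial_sum n x)"
    by (simp add: partial_sum_Suc norm_smul)
  also have "\<dots> \<le> norm (partial_sum (Suc n) x) + norm (partial_sum n x)"
    by (rule norm_triangle_ineq4)
  finally show ?thesis using assms[of n] assms[of "Suc n"] by linarith
qed

text \<open>
  This is completeness of the space for the norm \<open>SUP n. norm (partial_sum n x)\<close>: the coordinates of the
  \<open>w i\<close> converge, the limits are the coefficients of an expansion of \<open>x\<close> by uniformity in \<open>n\<close>, and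
  expansions are unique.
\<close>

lemma partial_sums_complete:
  assumes w: "w \<longlonglongrightarrow> x"
    and cauchy: "\<And>\<epsilon>. \<epsilon> > 0 \<Longrightarrow> \<exists>N. \<forall>i\<ge>N. \<forall>j\<ge>N. \<forall>n. norm (partial_sum n (w i - w j)) \<le> \<epsilon>"
  shows "(\<lambda>i. partial_sum n (w i)) \<longlonglongrightarrow> partial_sum n x"
proof -
  have "Cauchy (\<lambda>i. coord (w i) k)" for k
  proof (rule metric_CauchyI)
    fix \<epsilon> :: real assume \<epsilon>: "\<epsilon> > 0"
    have ek: "norm (e k) > 0" using basis_nonzero by simp
    define \<delta> where "\<delta> = \<epsilon> * norm (e k) / 4"
    have "\<delta> > 0" using \<epsilon> ek by (simp add: \<delta>_def)
    then obtain N where N: "\<And>i j n. i \<ge> N \<Longrightarrow> j \<ge> N \<Longrightarrow> norm (partial_sum n (w i - w j)) \<le> \<delta>"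
      using cauchy by blast
    have "dist (coord (w i) k) (coord (w j) k) < \<epsilon>" if "i \<ge> N" "j \<ge> N" for i j
    proof -
      have "dist (coord (w i) k) (coord (w j) k) * norm (e k) \<le> 2 * \<delta>"
        using norm_coord_le[of "w i - w j" \<delta> k] N[OF that] by (simp add: dist_norm coord_diff)
      also have "\<dots> < \<epsilon> * norm (e k)" using \<epsilon> ek by (simp add: \<delta>_def)
      finally show ?thesis using ek by simp
    qed
    then show "\<exists>M. \<forall>m\<ge>M. \<forall>n\<ge>M. dist (coord (w m) k) (coord (w n) k) < \<epsilon>"
      by blast
  qed
  then have "\<exists>l. (\<lambda>i. coord (w i) k) \<longlonglongrightarrow> l" for k
    by (simp add: Cauchy_convergent_iff convergent_def)
  then obtain a where a: "\<And>k. (\<lambda>i. coord (w i) k) \<longlonglongrightarrow> a k"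
    by metis
  define S where "S n = (\<Sum>k<n. smul (a k) (e k))" for n
  have S: "(\<lambda>i. partial_sum n (w i)) \<longlonglongrightarrow> S n" for n
    unfolding partial_sum_def S_def by (intro tendsto_sum tendsto_smul_left a)
  have "S \<longlonglongrightarrow> x"
  proof (rule LIMSEQ_I)
    fix \<epsilon> :: real assume "\<epsilon> > 0"
    then obtain N where N: "\<And>i j n. i \<ge> N \<Longrightarrow> j \<ge> N \<Longrightarrow> norm (partial_sum n (w i - w j)) \<le> \<epsilon> / 4"
      using cauchy[of "\<epsilon> / 4"] by auto
    obtain i0 where i0: "\<And>i. i \<ge> i0 \<Longrightarrow> norm (w i - x) < \<epsilon> / 4"
      using LIMSEQ_D[OF w, of "\<epsilon> / 4"] \<open>\<epsilon> > 0\<close> by auto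
    define i where "i = max i0 N"
    have i: "norm (w i - x) < \<epsilon> / 4" "N \<le> i"
      using i0 by (auto simp: i_def)
    have Si: "norm (partial_sum n (w i) - S n) \<le> \<epsilon> / 4" for n
    proof (rule tendsto_upperbound)
      show "(\<lambda>j. norm (partial_sum n (w i) - partial_sum n (w j))) \<longlonglongrightarrow> norm (partial_sum n (w i) - S n)"
        by (intro tendsto_norm tendsto_diff tendsto_const S)
      show "\<forall>\<^sub>F j in sequentially. norm (partial_sum n (w i) - partial_sum n (w j)) \<le> \<epsilon> / 4"
        using eventually_ge_at_top[of N]
        by eventually_elim (use N i(2) in \<open>simp flip: partial_sum_diff\<close>)
    qed simp
    obtain M where M: "\<And>n. n \<ge> M \<Longrightarrow> norm (partial_sum n (w i) - w i) < \<epsilon> / 4"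
      using LIMSEQ_D[OF partial_sum_tendsto, of "\<epsilon> / 4" "w i"] \<open>\<epsilon> > 0\<close> by auto
    have "norm (S n - x) < \<epsilon>" if "n \<ge> M" for n
    proof -
      have "S n - x = (partial_sum n (w i) - w i) + (w i - x) - (partial_sum n (w i) - S n)"
        by simp
      also have "norm \<dots> \<le> norm (partial_sum n (w i) - w i) + norm (w i - x)
          + norm (partial_sum n (w i) - S n)"
        using norm_triangle_ineq4[of "(partial_sum n (w i) - w i) + (w i - x)" "partial_sum n (w i) - S n"]
          norm_triangle_ineq[of "partial_sum n (w i) - w i" "w i - x"] by linarith
      finally show ?thesis using M[OF that] i(1) Si[of n] \<open>\<epsilon> > 0\<close> by linarith
    qed
    then show "\<exists>M. \<forall>n\<ge>M. norm (S n - x) < \<epsilon>" by blast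
  qed
  then have "coord x = a"
    by (intro coord_eqI) (simp add: sums_def S_def[abs_def])
  then have "partial_sum n x = S n"
    by (simp add: partial_sum_def S_def)
  with S show ?thesis by simp
qed

text \<open>
  Every \<open>x\<close> has bounded partial sums, so by the Baire category theorem the vectors with partial sums
  bounded by some \<open>M\<close> are dense in a ball. Differences of such vectors approximate all short vectors.
\<close>

lemma approx_bounded_partial_sums:
  obtains B where "B > 0"
    "\<And>x \<epsilon>. \<epsilon> > 0 \<Longrightarrow> \<exists>z. norm (x - z) < \<epsilon> \<and> (\<forall>n. norm (partial_sum n z) \<le> B * norm x)"
proof -
  define A where "A M = {x. \<forall>n. norm (partial_sum n x) \<le> real M}" for M :: nat
  have UN: "(\<Union>M. closure (A M)) = UNIV"
  proof -
    have "\<exists>M. x \<in> A M" for x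
    proof -
      have "Bseq (\<lambda>n. partial_sum n x)"
        using partial_sum_tendsto convergent_imp_Bseq convergent_def by blast
      then obtain K where "\<And>n. norm (partial_sum n x) \<le> K"
        unfolding Bseq_def by auto
      moreover obtain M :: nat where "K \<le> real M" using real_arch_simple by blast
      ultimately show ?thesis unfolding A_def by (blast intro: order_trans)
    qed
    then have "\<exists>M. x \<in> closure (A M)" for x
      by (meson closure_subset subsetD)
    then show ?thesis by auto
  qed
  have "\<exists>M. interior (closure (A M)) \<noteq> {}"
  proof (rule ccontr)
    assume "\<not> ?thesis"
    then have "euclidean interior_of \<Union>(range (\<lambda>M. closure (A M))) = {}"
      using completely_metrizable_space_euclidean
      by (intro Baire_category_alt) (auto simp: completely_metrizable_space_euclidean)
    with UN show False by simp
  qed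
  then obtain M x0 r where r: "r > 0" "ball x0 r \<subseteq> closure (A M)"
    by (meson equals0I mem_interior)
  define B where "B = 4 * (real M + 1) / r"
  have B: "B > 0" using r by (simp add: B_def)
  have "\<exists>z. norm (x - z) < \<epsilon> \<and> (\<forall>n. norm (partial_sum n z) \<le> B * norm x)"
    if \<epsilon>: "\<epsilon> > 0" for x \<epsilon>
  proof (cases "x = 0")
    case True
    then show ?thesis using \<epsilon> by (intro exI[of _ 0]) (simp add: partial_sum_def coord_zero)
  next
    case False
    define t where "t = r / (2 * norm x)"
    have t: "t > 0" using False r by (simp add: t_def)
    have "x0 + t *\<^sub>R x \<in> ball x0 r" "x0 \<in> ball x0 r"
      using r(1) False by (auto simp: dist_norm t_def)
    then have cl: "x0 + t *\<^sub>R x \<in> closure (A M)" "x0 \<in> closure (A M)"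
      using r by auto
    have pos: "t * \<epsilon> / 2 > 0" using t \<epsilon> by simp
    obtain p where p: "p \<in> A M" "norm (p - (x0 + t *\<^sub>R x)) < t * \<epsilon> / 2"
      using cl(1) pos unfolding closure_approachable dist_norm by blast
    obtain q where q: "q \<in> A M" "norm (q - x0) < t * \<epsilon> / 2"
      using cl(2) pos unfolding closure_approachable dist_norm by blast
    define z where "z = (1 / t) *\<^sub>R (p - q)"
    have "t *\<^sub>R (x - z) = (q - x0) - (p - (x0 + t *\<^sub>R x))"
      using t by (simp add: z_def scaleR_diff_right)
    then have "t * norm (x - z) = norm ((q - x0) - (p - (x0 + t *\<^sub>R x)))"
      using t by (metis abs_of_pos norm_scaleR)
    also have "\<dots> < t * \<epsilon>"
      using norm_triangle_ineq4[of "q - x0" "p - (x0 + t *\<^sub>R x)"] p(2) q(2) by linarith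
    finally have 1: "norm (x - z) < \<epsilon>" using t by simp
    have "norm (partial_sum n z) \<le> B * norm x" for n
    proof -
      have "norm (partial_sum n z) = (1 / t) * norm (partial_sum n p - partial_sum n q)"
        using t by (simp add: z_def partial_sum_scaleR partial_sum_diff)
      also have "\<dots> \<le> (1 / t) * (norm (partial_sum n p) + norm (partial_sum n q))"
        using t by (intro mult_left_mono norm_triangle_ineq4) simp
      also have "\<dots> \<le> (1 / t) * (2 * (real M + 1))"
      proof -
        have "norm (partial_sum n p) \<le> M" "norm (partial_sum n q) \<le> M"
          using p q by (auto simp: A_def)
        then show ?thesis using t by (intro mult_left_mono) auto
      qed
      also have "\<dots> = B * norm x" using False r by (simp add: t_def B_def field_simps)
      finally show ?thesis .
    qed
    with 1 show ?thesis by blast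
  qed
  with B show ?thesis using that by blast
qed

text \<open>
  The open mapping argument: correcting the error of an approximation again and again, with errors
  halved each time, writes \<open>x\<close> as a series of vectors whose partial sums are uniformly controlled by a
  geometric series.
\<close>

theorem partial_sum_bounded:
  obtains B where "\<And>x n. norm (partial_sum n x) \<le> B * norm x"
proof -
  obtain B where B: "B > 0"
    "\<And>x \<epsilon>. \<epsilon> > 0 \<Longrightarrow> \<exists>z. norm (x - z) < \<epsilon> \<and> (\<forall>n. norm (partial_sum n z) \<le> B * norm x)"
    using approx_bounded_partial_sums by blast
  have "norm (partial_sum n x) \<le> (2 * B) * norm x" for n x
  proof (cases "x = 0")
    case True
    then show ?thesis by (simp add: partial_sum_def coord_zero)
  next
    case False
    define c where "c = norm x"
    have c: "c > 0" using False by (simp add: c_def)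
    have "\<exists>z. norm (y - z) < c * (1/2) ^ Suc j \<and> (\<forall>n. norm (partial_sum n z) \<le> B * norm y)" for y j
      using B(2)[of "c * (1/2) ^ Suc j" y] c by simp
    then obtain Z where Z: "\<And>y j. norm (y - Z y j) < c * (1/2) ^ Suc j"
      "\<And>y j n. norm (partial_sum n (Z y j)) \<le> B * norm y"
      by metis
    define w where "w = rec_nat 0 (\<lambda>j v. v + Z (x - v) j)"
    have w0: "w 0 = 0" and wS: "w (Suc j) = w j + Z (x - w j) j" for j
      by (auto simp: w_def)
    have dist_w: "norm (x - w j) \<le> c * (1/2) ^ j" for j
    proof (cases j)
      case (Suc i)
      have "norm (x - w j) = norm ((x - w i) - Z (x - w i) i)"
        by (simp add: Suc wS algebra_simps)
      then show ?thesis using Z(1)[of "x - w i" i] Suc by simp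
    qed (simp add: w0 c_def)
    have geo: "(\<lambda>j. K * (1/2) ^ j) \<longlonglongrightarrow> 0" for K :: real
      using tendsto_mult_right_zero[OF LIMSEQ_power_zero[of "1/2 :: real"], of K] by simp
    have "\<forall>\<^sub>F j in sequentially. norm (w j - x) \<le> c * (1/2) ^ j"
      using dist_w by (simp add: norm_minus_commute[of _ x])
    then have "(\<lambda>j. w j - x) \<longlonglongrightarrow> 0"
      using geo[of c] by (rule Lim_null_comparison)
    then have wx: "w \<longlonglongrightarrow> x" by (rule LIM_zero_cancel)
    have step: "norm (partial_sum n (w (Suc j) - w j)) \<le> B * (c * (1/2) ^ j)" for n j
    proof -
      have "norm (partial_sum n (w (Suc j) - w j)) \<le> B * norm (x - w j)"
        using Z(2) by (simp add: wS)
      also have "\<dots> \<le> B * (c * (1/2) ^ j)"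
        using dist_w B(1) by (intro mult_left_mono) auto
      finally show ?thesis .
    qed
    have far: "norm (partial_sum n (w (i + d) - w i)) \<le> 2 * B * c * ((1/2) ^ i - (1/2) ^ (i + d))" for n i d
    proof (induction d)
      case (Suc d)
      have "norm (partial_sum n (w (i + Suc d) - w i)) =
          norm (partial_sum n (w (Suc (i + d)) - w (i + d)) + partial_sum n (w (i + d) - w i))"
        by (simp flip: partial_sum_add)
      also have "\<dots> \<le> B * (c * (1/2) ^ (i + d)) + 2 * B * c * ((1/2) ^ i - (1/2) ^ (i + d))"
        by (rule norm_triangle_mono[OF step Suc.IH])
      also have "\<dots> = 2 * B * c * ((1/2) ^ i - (1/2) ^ (i + Suc d))"
        by (simp add: algebra_simps)
      finally show ?case .
    qed (simp add: partial_sum_def coord_zero)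
    have far': "norm (partial_sum n (w j - w i)) \<le> 2 * B * c * (1/2) ^ i" if "i \<le> j" for n i j
    proof -
      have "norm (partial_sum n (w j - w i)) \<le> 2 * B * c * ((1/2) ^ i - (1/2) ^ j)"
        using far[of n i "j - i"] that by simp
      also have "\<dots> \<le> 2 * B * c * (1/2) ^ i"
        using B(1) c by (intro mult_left_mono) auto
      finally show ?thesis .
    qed
    have "(\<lambda>j. partial_sum n (w j)) \<longlonglongrightarrow> partial_sum n x"
    proof (rule partial_sums_complete[OF wx])
      fix \<epsilon> :: real assume "\<epsilon> > 0"
      then have "\<forall>\<^sub>F i in sequentially. 2 * B * c * (1/2) ^ i < \<epsilon>"
        using geo[of "2 * B * c"] by (rule order_tendstoD(2)[rotated])
      then obtain N where N: "\<And>i. i \<ge> N \<Longrightarrow> 2 * B * c * (1/2) ^ i < \<epsilon>"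
        unfolding eventually_sequentially by blast
      have "norm (partial_sum n (w i - w j)) \<le> \<epsilon>" if "i \<ge> N" "j \<ge> N" for i j n
      proof (cases "i \<le> j")
        case True
        have "norm (partial_sum n (w i - w j)) = norm (partial_sum n (w j - w i))"
          by (simp add: partial_sum_diff norm_minus_commute)
        then show ?thesis using far'[OF True, of n] N[OF that(1)] by simp
      next
        case False
        then show ?thesis using far'[of j i n] N[OF that(2)] by simp
      qed
      then show "\<exists>N. \<forall>i\<ge>N. \<forall>j\<ge>N. \<forall>n. norm (partial_sum n (w i - w j)) \<le> \<epsilon>"
        by blast
    qed
    then have "(\<lambda>j. norm (partial_sum n (w j))) \<longlonglongrightarrow> norm (partial_sum n x)"
      by (rule tendsto_norm)
    moreover have "norm (partial_sum n (w j)) \<le> 2 * B * c" for j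
      using far'[of 0 j n] by (simp add: w0)
    ultimately have "norm (partial_sum n x) \<le> 2 * B * c"
      by (intro LIMSEQ_le_const2) auto
    then show ?thesis by (simp add: c_def)
  qed
  then show ?thesis using that by blast
qed

corollary coord_bounded: "\<exists>K. \<forall>x. norm (coord x n) \<le> K * norm x"
proof -
  obtain B where B: "\<And>x n. norm (partial_sum n x) \<le> B * norm x"
    using partial_sum_bounded by blast
  have ek: "norm (e n) > 0" using basis_nonzero by simp
  have "norm (coord x n) \<le> (2 * B / norm (e n)) * norm x" for x
    using norm_coord_le[of x "B * norm x" n] B ek by (simp add: field_simps)
  then show ?thesis by blast
qed

lemma bounded_linear_coord: "bounded_linear (\<lambda>x. coord x n)"
proof -
  obtain K where "\<And>x. norm (coord x n) \<le> K * norm x"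
    using coord_bounded by blast
  then show ?thesis
    by (intro bounded_linear_intro[of _ K])
      (auto simp: coord_add coord_smul scaleR_conv_of_real mult.commute simp flip: smul_of_real)
qed

text \<open>
  Continuity of the coordinates makes the right-hand side closed, and the partial sums of the expansion show that
  it is contained in the closed span.
\<close>

lemma closed_span_eq: "closed_span smul (e ` u) = {x. \<forall>n. n \<notin> u \<longrightarrow> coord x n = 0}"
  (is "_ = ?Z")
proof
  have sub: "subspace ?Z"
    by (rule subspaceI) (auto simp: coord_zero coord_add coord_smul)
  have "e ` u \<subseteq> ?Z"
    by (auto simp: coord_basis)
  then have "span (e ` u) \<subseteq> ?Z"
    using sub by (rule span_minimal)
  moreover have "closed ?Z"
  proof -
    have "closed ((\<lambda>x. coord x n) -` {0})" for n
      using bounded_linear_coord linear_continuous_on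
      by (intro closed_vimage) (auto simp: linear_continuous_on)
    moreover have "?Z = (\<Inter>n\<in>-u. (\<lambda>x. coord x n) -` {0})" by auto
    ultimately show ?thesis by (metis (no_types, lifting) closed_INT)
  qed
  ultimately show "closed_span smul (e ` u) \<subseteq> ?Z"
    unfolding closed_span_def by (rule closure_minimal)
  show "?Z \<subseteq> closed_span smul (e ` u)"
  proof
    fix x assume x: "x \<in> ?Z"
    have "smul (coord x k) (e k) \<in> span (e ` u)" for k
      using x by (cases "k \<in> u") (auto intro: span_scale span_base span_zero)
    then have "partial_sum n x \<in> span (e ` u)" for n
      unfolding partial_sum_def by (rule span_sum)
    then show "x \<in> closed_span smul (e ` u)"
      unfolding closed_span_def closure_sequential
      by (intro exI[of _ "\<lambda>n. partial_sum n x"] conjI allI partial_sum_tendsto)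
  qed
qed

end

text \<open>
  Finite combinations of basis vectors with coefficients from a countable dense set of scalars; a coordinate that
  vanishes for \<open>x\<close> is replaced by zero, so that the support does not grow.
\<close>

lemma (in schauder_space) countable_approximants:
  obtains P where "countable P"
    "\<And>x \<epsilon>. \<epsilon> > 0 \<Longrightarrow> \<exists>p\<in>P. norm (x - p) < \<epsilon> \<and> (\<forall>n. coord x n = 0 \<longrightarrow> coord p n = 0)"
proof -
  obtain D :: "'k set" where D: "countable D" "\<And>U. open U \<Longrightarrow> U \<noteq> {} \<Longrightarrow> \<exists>d\<in>D. d \<in> U"
    using countable_dense_setE by blast
  define val where "val c = (\<Sum>k<length c. smul (c ! k) (e k))" for c
  define P where "P = val ` lists (insert 0 D)"
  have "\<exists>p\<in>P. norm (x - p) < \<epsilon> \<and> (\<forall>n. coord x n = 0 \<longrightarrow> coord p n = 0)" if \<epsilon>: "\<epsilon> > 0" for x \<epsilon>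
  proof -
    obtain n where n: "norm (partial_sum n x - x) < \<epsilon> / 2"
      using LIMSEQ_D[OF partial_sum_tendsto, of "\<epsilon> / 2" x] \<epsilon> by auto
    define \<eta> where "\<eta> = \<epsilon> / (2 * (real n + 1))"
    have \<eta>: "\<eta> > 0" using \<epsilon> by (simp add: \<eta>_def)
    have "\<exists>d\<in>insert 0 D. norm (smul (coord x k - d) (e k)) \<le> \<eta> \<and> (coord x k = 0 \<longrightarrow> d = 0)" for k
    proof (cases "coord x k = 0")
      case False
      have ek: "norm (e k) > 0" using basis_nonzero by simp
      have "ball (coord x k) (\<eta> / norm (e k)) \<noteq> {}"
        using divide_pos_pos[OF \<eta> ek] by (simp only: ball_eq_empty not_le simp_thms)
      then obtain d where "d \<in> D" "d \<in> ball (coord x k) (\<eta> / norm (e k))"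
        using D(2) open_ball by metis
      then have "d \<in> D" "norm (smul (coord x k - d) (e k)) \<le> \<eta>"
        unfolding norm_smul using ek by (simp_all add: dist_norm pos_less_divide_eq)
      with False show ?thesis by blast
    qed (use \<eta> in auto)
    then obtain d where d: "\<And>k. d k \<in> insert 0 D" "\<And>k. norm (smul (coord x k - d k) (e k)) \<le> \<eta>"
      "\<And>k. coord x k = 0 \<Longrightarrow> d k = 0"
      by metis
    define p where "p = (\<Sum>k<n. smul (d k) (e k))"
    have "p = val (map d [0..<n])" by (simp add: p_def val_def)
    moreover have "map d [0..<n] \<in> lists (insert 0 D)"
      using d(1) by (auto simp: in_lists_conv_set simp del: insert_iff)
    ultimately have "p \<in> P" unfolding P_def by (rule image_eqI)
    moreover have "norm (x - p) < \<epsilon>"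
    proof -
      have "partial_sum n x - p = (\<Sum>k<n. smul (coord x k - d k) (e k))"
        by (simp add: partial_sum_def p_def scale_left_diff_distrib sum_subtractf)
      then have "norm (partial_sum n x - p) \<le> real n * \<eta>"
        using sum_norm_bound[of "{..<n}" "\<lambda>k. smul (coord x k - d k) (e k)" \<eta>] d(2) by simp
      also have "\<dots> \<le> \<epsilon> / 2" using \<epsilon> by (simp add: \<eta>_def field_simps)
      finally show ?thesis
        using n norm_triangle_ineq4[of "partial_sum n x - p" "partial_sum n x - x"] by simp
    qed
    moreover have "\<forall>k. coord x k = 0 \<longrightarrow> coord p k = 0"
      using d(3) by (simp add: p_def coord_finite_sum)
    ultimately show ?thesis by blast
  qed
  moreover have "countable P"
    unfolding P_def using D(1) by (intro countable_image countable_lists) simp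
  ultimately show ?thesis using that by blast
qed

section \<open>Isomorphic embeddings as operators bounded above and below\<close>

text \<open>
  Taking \<open>F\<close> to be the identity bounds a continuous operator \<open>G\<close>, and taking \<open>G\<close> to be the identity
  bounds the inverse of \<open>F\<close>.
\<close>

lemma homogeneous_bound:
  fixes F :: "'a::real_normed_vector \<Rightarrow> 'b::real_normed_vector"
    and G :: "'a \<Rightarrow> 'c::real_normed_vector"
  assumes F: "\<And>r y. F (r *\<^sub>R y) = r *\<^sub>R F y" and G: "\<And>r y. G (r *\<^sub>R y) = r *\<^sub>R G y"
    and inj: "\<And>y. F y = 0 \<Longrightarrow> G y = 0"
    and \<delta>: "\<delta> > 0" "\<And>y. norm (F y) < \<delta> \<Longrightarrow> norm (G y) < 1"
  shows "norm (G y) \<le> (2 / \<delta>) * norm (F y)"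
proof (cases "F y = 0")
  case False
  define c where "c = \<delta> / (2 * norm (F y))"
  have c: "c > 0" using False \<delta>(1) by (simp add: c_def)
  have "norm (F (c *\<^sub>R y)) < \<delta>"
    using False \<delta>(1) c by (simp add: F c_def)
  then have "c * norm (G y) < 1"
    using \<delta>(2) c by (force simp: G)
  then show ?thesis using False \<delta>(1) by (simp add: c_def field_simps)
qed (simp add: inj)

text \<open>
  Closedness of the range and continuity of the inverse are both contained in the lower bound for \<open>T\<close>;
  a natural number as the bound leaves only countably many possibilities to be coded.
\<close>

lemma embeds_isomorphically_iff_bounds:
  assumes X: "banach_space_over scaleX" and Y: "banach_space_over scaleY"
  shows "embeds_isomorphically scaleY scaleX Z \<longleftrightarrow>
    (\<exists>T (K::nat). Vector_Spaces.linear scaleY scaleX T \<and> range T \<subseteq> Z \<and>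
      (\<forall>y. norm (T y) \<le> K * norm y \<and> norm y \<le> K * norm (T y)))"
    (is "?L \<longleftrightarrow> ?R")
proof -
  have real_scale: "T (r *\<^sub>R y) = r *\<^sub>R T y" if "Vector_Spaces.linear scaleY scaleX T" for T r y
    using that banach_space_over.smul_of_real[OF X] banach_space_over.smul_of_real[OF Y]
    unfolding Vector_Spaces.linear_iff by metis
  show ?thesis
  proof
    assume ?L
    then obtain T S where T: "Vector_Spaces.linear scaleY scaleX T" "range T \<subseteq> Z"
      and hom: "homeomorphism UNIV (range T) T S"
      unfolding embeds_isomorphically_def by blast
    note scale = real_scale[OF T(1)]
    have T0: "T 0 = 0" using scale[of 0 0] by simp
    have ST: "S (T y) = y" for y using hom by (simp add: homeomorphism_def)
    have "continuous_on UNIV T" "continuous_on (range T) S"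
      using hom by (auto simp: homeomorphism_def)
    then obtain \<delta> \<delta>' where \<delta>: "\<delta> > 0" "\<And>y. norm y < \<delta> \<Longrightarrow> norm (T y) < 1"
      and \<delta>': "\<delta>' > 0" "\<And>y. norm (T y) < \<delta>' \<Longrightarrow> norm y < 1"
      unfolding continuous_on_iff using T0 ST
      by (metis UNIV_I dist_0_norm dist_commute rangeI zero_less_one)
    have up: "norm (T y) \<le> (2 / \<delta>) * norm y" for y
      using homogeneous_bound[of "\<lambda>y. y" T \<delta> y] scale \<delta> T0 by simp
    have low: "norm y \<le> (2 / \<delta>') * norm (T y)" for y
      using homogeneous_bound[of T "\<lambda>y. y" \<delta>' y] scale \<delta>' T0 ST by metis
    obtain K :: nat where K: "max (2 / \<delta>) (2 / \<delta>') \<le> K" using real_arch_simple by blast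
    have "norm (T y) \<le> K * norm y \<and> norm y \<le> K * norm (T y)" for y
    proof
      have "(2 / \<delta>) * norm y \<le> K * norm y" using K by (intro mult_right_mono) auto
      with up[of y] show "norm (T y) \<le> K * norm y" by linarith
      have "(2 / \<delta>') * norm (T y) \<le> K * norm (T y)" using K by (intro mult_right_mono) auto
      with low[of y] show "norm y \<le> K * norm (T y)" by linarith
    qed
    with T show ?R by blast
  next
    assume ?R
    then obtain T K where T: "Vector_Spaces.linear scaleY scaleX T" "range T \<subseteq> Z"
      and bd: "\<And>y. norm (T y) \<le> real K * norm y" "\<And>y. norm y \<le> real K * norm (T y)"
      by blast
    have add: "T (y + z) = T y + T z" for y z
      using T(1) unfolding Vector_Spaces.linear_iff by blast
    then have diff: "T (y - z) = T y - T z" for y z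
      by (metis add_diff_cancel diff_add_cancel)
    have blT: "bounded_linear T"
      using add real_scale[OF T(1)] bd(1) by (intro bounded_linear_intro[of T "real K"]) (auto simp: mult.commute)
    have low: "norm y \<le> (real K + 1) * norm (T y)" for y
      using bd(2)[of y] norm_ge_zero[of "T y"] unfolding distrib_right mult_1_left by linarith
    have injT: "inj T"
    proof (rule injI)
      fix y z assume "T y = T z"
      then show "y = z" using low[of "y - z"] by (simp add: diff)
    qed
    have "complete (range T)"
      using low by (intro complete_isometric_image[of "1 / (real K + 1)"] blT)
        (auto simp: field_simps complete_UNIV)
    then have closed: "closed (range T)" by (rule complete_imp_closed)
    have "norm (inv T x - inv T y) \<le> (real K + 1) * norm (x - y)" if "x \<in> range T" "y \<in> range T" for x y
      using low[of "inv T x - inv T y"] that by (simp add: diff f_inv_into_f)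
    then have "(real K + 1)-lipschitz_on (range T) (inv T)"
      by (intro lipschitz_onI) (auto simp: dist_norm)
    then have "continuous_on (range T) (inv T)"
      by (rule lipschitz_on_continuous_on)
    then have "homeomorphism UNIV (range T) T (inv T)"
      using injT linear_continuous_on[OF blT] by (auto simp: homeomorphism_def inv_f_f image_image)
    with T closed show ?L
      unfolding embeds_isomorphically_def by blast
  qed
qed

section \<open>Exchanging basis vectors\<close>

locale embedding_problem = schauder_space scaleX e + Y: banach_space_over scaleY
  for scaleX :: "'k::{real_normed_field, euclidean_space} \<Rightarrow> 'a::banach \<Rightarrow> 'a"
    and e :: "nat \<Rightarrow> 'a"
    and scaleY :: "'k \<Rightarrow> 'b::banach \<Rightarrow> 'b"
begin

definition embeds :: "nat set \<Rightarrow> bool" where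
  "embeds u \<longleftrightarrow> embeds_isomorphically scaleY scaleX (closed_span scaleX (e ` u))"

lemma embeds_iff:
  "embeds u \<longleftrightarrow> (\<exists>T (K::nat). Vector_Spaces.linear scaleY scaleX T \<and>
    (\<forall>y n. n \<notin> u \<longrightarrow> coord (T y) n = 0) \<and>
    (\<forall>y. norm (T y) \<le> K * norm y \<and> norm y \<le> K * norm (T y)))"
  unfolding embeds_def
    embeds_isomorphically_iff_bounds[OF banach_space_over_axioms Y.banach_space_over_axioms]
    closed_span_eq image_subset_iff mem_Collect_eq by simp

lemma embeds_mono: "embeds u \<Longrightarrow> u \<subseteq> v \<Longrightarrow> embeds v"
  unfolding embeds_iff by blast

lemma linear_iff:
  "Vector_Spaces.linear scaleY scaleX T \<longleftrightarrow>
    (\<forall>y z. T (y + z) = T y + T z) \<and> (\<forall>c y. T (scaleY c y) = scaleX c (T y))"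
  using vector_space_axioms Y.vector_space_axioms
  by (auto simp: Vector_Spaces.linear_iff)

text \<open>
  The operator \<open>R\<close> exchanges \<open>e p\<close> for \<open>e q\<close>. On vectors with vanishing \<open>q\<close>-coordinate
  the \<open>p\<close>-coordinate can be read off from the \<open>q\<close>-coordinate of the image, so that \<open>R\<close> is
  bounded below there.
\<close>

lemma embeds_swap:
  assumes u: "embeds u" and p: "p \<in> u" and q: "q \<notin> u"
  shows "embeds (insert q (u - {p}))"
proof -
  obtain T K where lin: "Vector_Spaces.linear scaleY scaleX T"
    and supp: "\<And>y n. n \<notin> u \<Longrightarrow> coord (T y) n = 0"
    and bd: "\<And>y. norm (T y) \<le> real K * norm y" "\<And>y. norm y \<le> real K * norm (T y)"
    using u unfolding embeds_iff by blast
  have pq: "p \<noteq> q" using p q by blast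
  define b where "b = e p - e q"
  obtain Lp Lq where Lp: "\<And>x. norm (coord x p) \<le> Lp * norm x"
    and Lq: "\<And>x. norm (coord x q) \<le> Lq * norm x"
    using coord_bounded by metis
  define C where "C = max 0 (max Lp Lq)"
  have "Lp * norm x \<le> C * norm x" "Lq * norm x \<le> C * norm x" for x
    by (auto simp: C_def intro!: mult_right_mono)
  then have C: "norm (coord x p) \<le> C * norm x" "norm (coord x q) \<le> C * norm x" for x
    using Lp Lq order_trans by blast+
  define L where "L = 1 + C * norm b"
  have L: "L \<ge> 1" by (simp add: L_def C_def)
  have shift: "norm x + norm (scaleX c b) \<le> L * norm x" if "norm c \<le> C * norm x" for x c
    using mult_right_mono[OF that, of "norm b"] by (simp add: norm_smul L_def algebra_simps)
  define R where "R x = x - scaleX (coord x p) b" for x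
  have R_coord: "coord (R x) n = (if n = p then 0 else if n = q then coord x q + coord x p else coord x n)"
    for x n
    using pq by (auto simp: R_def b_def coord_diff coord_smul coord_basis)
  have R_inv: "x = R x + scaleX (coord (R x) q) b" if "coord x q = 0" for x
    using that pq by (simp add: R_coord) (simp add: R_def)
  have R_up: "norm (R x) \<le> L * norm x" for x
    using norm_triangle_ineq4[of x "scaleX (coord x p) b"] shift[OF C(1)[of x]] by (simp add: R_def)
  have R_low: "norm x \<le> L * norm (R x)" if "coord x q = 0" for x
    using norm_triangle_ineq[of "R x" "scaleX (coord (R x) q) b"] shift[OF C(2)[of "R x"]]
      R_inv[OF that] by simp
  obtain M :: nat where M: "L * real K \<le> real M" using real_arch_simple by blast
  show ?thesis
    unfolding embeds_iff
  proof (intro exI conjI allI impI)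
    show "Vector_Spaces.linear scaleY scaleX (\<lambda>y. R (T y))"
      using lin unfolding linear_iff
      by (auto simp: R_def coord_add coord_smul scale_left_distrib scale_right_diff_distrib)
    show "coord (R (T y)) n = 0" if "n \<notin> insert q (u - {p})" for y n
      using that supp by (auto simp: R_coord)
    show "norm (R (T y)) \<le> real M * norm y" for y
    proof -
      have "norm (R (T y)) \<le> L * norm (T y)" by (rule R_up)
      also have "\<dots> \<le> L * (real K * norm y)" using L bd by (intro mult_left_mono) auto
      also have "\<dots> \<le> real M * norm y" using mult_right_mono[OF M, of "norm y"] by (simp add: mult.assoc)
      finally show ?thesis .
    qed
    show "norm y \<le> real M * norm (R (T y))" for y
    proof -
      have "norm y \<le> real K * norm (T y)" by (rule bd)
      also have "\<dots> \<le> real K * (L * norm (R (T y)))"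
        using R_low supp[OF q] by (intro mult_left_mono) auto
      also have "\<dots> \<le> real M * norm (R (T y))"
        using mult_right_mono[OF M, of "norm (R (T y))"] by (simp add: ac_simps)
      finally show ?thesis .
    qed
  qed
qed

lemma embeds_avoiding_initial_segment:
  assumes "embeds u" "infinite (- u)"
  shows "\<exists>v. embeds v \<and> v \<inter> {..<n} = {} \<and> finite (v - u) \<and> infinite (- v)"
proof (induction n)
  case 0
  show ?case using assms by (intro exI[of _ u]) auto
next
  case (Suc n)
  then obtain v where v: "embeds v" "v \<inter> {..<n} = {}" "finite (v - u)" "infinite (- v)" by blast
  show ?case
  proof (cases "n \<in> v")
    case True
    obtain q where q: "q > n" "q \<notin> v" using v(4) by (auto simp: infinite_nat_iff_unbounded)
    let ?w = "insert q (v - {n})"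
    have "embeds ?w" using v(1) True q(2) by (rule embeds_swap)
    moreover have "?w \<inter> {..<Suc n} = {}" using v(2) q(1) by (auto simp: less_Suc_eq)
    moreover have "finite (?w - u)" by (rule finite_subset[of _ "insert q (v - u)"]) (use v(3) in auto)
    moreover have "infinite (- ?w)"
    proof -
      have "- v \<subseteq> insert q (- ?w)" by auto
      then show ?thesis using v(4) by (meson finite.insertI finite_subset)
    qed
    ultimately show ?thesis by blast
  next
    case False
    then have "v \<inter> {..<Suc n} = {}" using v(2) by (auto simp: less_Suc_eq)
    with v show ?thesis by blast
  qed
qed

text \<open>
  An embedding over \<open>u\<close> yields one over a set \<open>v\<close> in \<open>{n..}\<close> that adds finitely many elements to \<open>u\<close>,
  and these do not influence which intervals are met eventually. A cofinite \<open>u\<close> leaves no room for the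
  exchange, but it meets almost all nonempty intervals anyway.
\<close>

lemma small_embeds_tail_imp_small:
  assumes "small {u. embeds (u \<inter> {n..})}"
  shows "small {u. embeds u}"
proof -
  obtain h where h: "\<And>u. embeds (u \<inter> {n..}) \<Longrightarrow> \<forall>\<^sub>F k in sequentially. u \<inter> {k..<h k} \<noteq> {}"
    using assms unfolding small_def by blast
  have "\<forall>\<^sub>F k in sequentially. u \<inter> {k..<max (Suc k) (h k)} \<noteq> {}" if u: "embeds u" for u
  proof (cases "finite (- u)")
    case True
    then obtain N where N: "\<And>k. k \<in> - u \<Longrightarrow> k < N"
      by (auto simp: finite_nat_set_iff_bounded)
    show ?thesis
      using eventually_ge_at_top[of N]
    proof eventually_elim
      case (elim k)
      then have "k \<in> u \<inter> {k..<max (Suc k) (h k)}" using N[of k] by auto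
      then show ?case by blast
    qed
  next
    case False
    then obtain v where v: "embeds v" "v \<inter> {..<n} = {}" "finite (v - u)"
      using embeds_avoiding_initial_segment u by blast
    have "v \<inter> {n..} = v" using v(2) by (auto simp: not_less[symmetric])
    then have hv: "\<forall>\<^sub>F k in sequentially. v \<inter> {k..<h k} \<noteq> {}" using h v(1) by simp
    obtain N where N: "\<And>k. k \<in> v - u \<Longrightarrow> k < N"
      using v(3) by (auto simp: finite_nat_set_iff_bounded)
    show ?thesis
      using hv eventually_ge_at_top[of N]
    proof eventually_elim
      case (elim k)
      then obtain x where x: "x \<in> v" "k \<le> x" "x < h k" by auto
      with elim N[of x] have "x \<in> u \<inter> {k..<max (Suc k) (h k)}" by auto
      then show ?case by blast
    qed
  qed
  then show ?thesis
    unfolding small_def by (intro exI[of _ "\<lambda>k. max (Suc k) (h k)"]) simp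
qed

section \<open>Coding embeddings by sequences\<close>

text \<open>
  Points whose images under \<open>T\<close> are close to elements of a countable dense set \<open>P\<close> are dense, because
  \<open>T\<close> is bounded below. Asking for approximation at arbitrarily late
  indices lets the index of a term also measure its accuracy in the codes below.
\<close>

lemma embeds_imp_separable:
  assumes "embeds u"
  obtains d :: "nat \<Rightarrow> 'b" where "\<And>y \<epsilon> N. \<epsilon> > 0 \<Longrightarrow> \<exists>n\<ge>N. norm (d n - y) < \<epsilon>"
proof -
  obtain T K where lin: "Vector_Spaces.linear scaleY scaleX T"
    and bd: "\<And>y. norm y \<le> real K * norm (T y)"
    using assms unfolding embeds_iff by blast
  have Tdiff: "T (y - z) = T y - T z" for y z
    using lin unfolding linear_iff by (metis add_diff_cancel diff_add_cancel)
  obtain P where P: "countable P"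
    "\<And>x \<epsilon>. \<epsilon> > 0 \<Longrightarrow> \<exists>p\<in>P. norm (x - p) < \<epsilon> \<and> (\<forall>n. coord x n = 0 \<longrightarrow> coord p n = 0)"
    using countable_approximants by blast
  have Pne: "P \<noteq> {}" using P(2)[of 1] by auto
  define d where "d n = (case prod_decode n of (i, m) \<Rightarrow>
    (SOME y. norm (T y - from_nat_into P i) < 1 / real (Suc m)))" for n
  have "\<exists>n\<ge>N. norm (d n - y) < \<epsilon>" if \<epsilon>: "\<epsilon> > 0" for y \<epsilon> N
  proof -
    obtain m0 :: nat where m0: "2 * real K / \<epsilon> < real m0" using reals_Archimedean2 by blast
    define m where "m = max N m0"
    have m: "2 * real K / \<epsilon> < real (Suc m)" "m \<ge> N" using m0 by (auto simp: m_def)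
    obtain x where x: "x \<in> P" "norm (T y - x) < 1 / real (Suc m)"
      using P(2)[of "1 / real (Suc m)"] by auto
    obtain i where i: "from_nat_into P i = x"
      using x(1) P(1) Pne by (metis from_nat_into_to_nat_on)
    define n where "n = prod_encode (i, m)"
    have "norm (T (d n) - x) < 1 / real (Suc m)"
      using someI[of "\<lambda>y. norm (T y - x) < 1 / real (Suc m)", OF x(2)] i
      by (simp add: d_def n_def)
    then have "norm (T (d n) - T y) < 2 / real (Suc m)"
      using x(2) norm_triangle_ineq4[of "T (d n) - x" "T y - x"] by simp
    then have "real K * norm (T (d n - y)) \<le> real K * (2 / real (Suc m))"
      unfolding Tdiff by (intro mult_left_mono) auto
    also have "\<dots> < \<epsilon>" using m(1) \<epsilon> by (simp add: field_simps)
    finally have "norm (d n - y) < \<epsilon>" using bd[of "d n - y"] by linarith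
    moreover have "n \<ge> N" unfolding n_def using le_prod_encode_2 m(2) order_trans by blast
    ultimately show ?thesis by blast
  qed
  then show ?thesis using that by blast
qed

text \<open>
  A code consists of pairs \<open>(K, p i)\<close> with a constant \<open>K\<close>, where \<open>p i\<close> stands for an approximation
  of \<open>T (d i)\<close> with error at most \<open>1 / Suc i\<close>. The second condition makes \<open>T\<close> linear and bounded by \<open>K\<close> at
  once, and the third one bounds the inverse; both are relaxed by the errors of the approximations. Each condition
  involves finitely many entries only, hence the set of codes is closed.
\<close>

definition codes :: "(nat \<Rightarrow> 'b) \<Rightarrow> 'a set \<Rightarrow> (nat \<Rightarrow> nat \<times> 'a) set" where
  "codes d P = {f. (\<forall>i. fst (f i) = fst (f 0) \<and> snd (f i) \<in> P) \<and>
    (\<forall>a b i j l. norm (scaleX a (snd (f i)) + scaleX b (snd (f j)) - snd (f l)) \<le>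
        fst (f 0) * norm (scaleY a (d i) + scaleY b (d j) - d l)
        + (norm a / real (Suc i) + norm b / real (Suc j) + 1 / real (Suc l))) \<and>
    (\<forall>i j. norm (d i - d j) \<le>
        fst (f 0) * (norm (snd (f i) - snd (f j)) + 1 / real (Suc i) + 1 / real (Suc j)))}"

lemma codes_closed:
  assumes "\<And>m. \<exists>g\<in>codes d P. \<forall>i<m. g i = f i"
  shows "f \<in> codes d P"
proof -
  have *: "\<exists>g\<in>codes d P. g 0 = f 0 \<and> g i = f i \<and> g j = f j \<and> g l = f l" for i j l
  proof -
    obtain g where "g \<in> codes d P" "\<forall>k<Suc (i + j + l). g k = f k"
      using assms by blast
    then show ?thesis by (intro bexI[of _ g]) auto
  qed
  show ?thesis
    unfolding codes_def mem_Collect_eq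
  proof (intro conjI allI)
    fix i j l a b
    obtain g where g: "g \<in> codes d P" "g 0 = f 0" "g i = f i" "g j = f j" "g l = f l"
      using * by blast
    show "fst (f i) = fst (f 0)" "snd (f i) \<in> P"
      using g(1) unfolding codes_def mem_Collect_eq g(2,3)[symmetric] by blast+
    show "norm (scaleX a (snd (f i)) + scaleX b (snd (f j)) - snd (f l)) \<le>
        fst (f 0) * norm (scaleY a (d i) + scaleY b (d j) - d l)
        + (norm a / real (Suc i) + norm b / real (Suc j) + 1 / real (Suc l))"
      using g(1) unfolding codes_def mem_Collect_eq g(2-5)[symmetric] by blast
    show "norm (d i - d j) \<le>
        fst (f 0) * (norm (snd (f i) - snd (f j)) + 1 / real (Suc i) + 1 / real (Suc j))"
      using g(1) unfolding codes_def mem_Collect_eq g(2-5)[symmetric] by blast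
  qed
qed

definition code_support :: "nat \<times> 'a \<Rightarrow> nat set" where
  "code_support c = {n. coord (snd c) n \<noteq> 0}"

lemma embeds_imp_code:
  assumes P: "\<And>x \<epsilon>. \<epsilon> > 0 \<Longrightarrow> \<exists>p\<in>P. norm (x - p) < \<epsilon> \<and> (\<forall>n. coord x n = 0 \<longrightarrow> coord p n = 0)"
    and u: "embeds u"
  shows "\<exists>f\<in>codes d P. \<forall>i. code_support (f i) \<subseteq> u"
proof -
  obtain T K where lin: "Vector_Spaces.linear scaleY scaleX T"
    and supp: "\<And>y n. n \<notin> u \<Longrightarrow> coord (T y) n = 0"
    and bd: "\<And>y. norm (T y) \<le> real K * norm y" "\<And>y. norm y \<le> real K * norm (T y)"
    using u unfolding embeds_iff by blast
  have Tadd: "T (y + z) = T y + T z" and Tscale: "T (scaleY c y) = scaleX c (T y)" for y z c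
    using lin unfolding linear_iff by auto
  have Tdiff: "T (y - z) = T y - T z" for y z
    using Tadd by (metis add_diff_cancel diff_add_cancel)
  have "\<exists>p\<in>P. norm (T (d i) - p) < 1 / real (Suc i) \<and> (\<forall>n. coord (T (d i)) n = 0 \<longrightarrow> coord p n = 0)" for i
    using P[of "1 / real (Suc i)"] by simp
  then obtain p where p: "\<And>i. p i \<in> P" "\<And>i. norm (T (d i) - p i) < 1 / real (Suc i)"
    "\<And>i n. coord (T (d i)) n = 0 \<Longrightarrow> coord (p i) n = 0"
    by metis
  define r where "r i = T (d i) - p i" for i
  have r: "norm (r i) \<le> 1 / real (Suc i)" for i
    using p(2)[of i] by (simp add: r_def)
  have pr: "p i = T (d i) - r i" for i by (simp add: r_def)
  define f where "f i = (K, p i)" for i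
  have "f \<in> codes d P"
    unfolding codes_def mem_Collect_eq
  proof (intro conjI allI)
    fix i j l a b
    show "fst (f i) = fst (f 0)" "snd (f i) \<in> P" by (simp_all add: f_def p)
    have ri: "norm (scaleX c (r i)) \<le> norm c / real (Suc i)" for c i
      using mult_left_mono[OF r[of i] norm_ge_zero[of c]] by (simp add: norm_smul)
    have "scaleX a (p i) + scaleX b (p j) - p l =
        T (scaleY a (d i) + scaleY b (d j) - d l) - (scaleX a (r i) + scaleX b (r j) - r l)"
      by (simp add: pr Tadd Tdiff Tscale scale_right_diff_distrib)
    also have "norm \<dots> \<le> norm (T (scaleY a (d i) + scaleY b (d j) - d l))
        + norm (scaleX a (r i) + scaleX b (r j) - r l)"
      by (rule norm_triangle_ineq4)
    also have "norm (scaleX a (r i) + scaleX b (r j) - r l) \<le>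
        norm a / real (Suc i) + norm b / real (Suc j) + 1 / real (Suc l)"
      using norm_triangle_ineq4[of "scaleX a (r i) + scaleX b (r j)" "r l"]
        norm_triangle_ineq[of "scaleX a (r i)" "scaleX b (r j)"] ri[of a i] ri[of b j] r[of l]
      by linarith
    finally show "norm (scaleX a (snd (f i)) + scaleX b (snd (f j)) - snd (f l)) \<le>
        fst (f 0) * norm (scaleY a (d i) + scaleY b (d j) - d l)
        + (norm a / real (Suc i) + norm b / real (Suc j) + 1 / real (Suc l))"
      using bd(1)[of "scaleY a (d i) + scaleY b (d j) - d l"] by (simp add: f_def)
    have "norm (T (d i - d j)) \<le> norm (p i - p j) + 1 / real (Suc i) + 1 / real (Suc j)"
    proof -
      have eq: "T (d i - d j) = (p i - p j) + r i - r j" by (simp add: Tdiff pr)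
      show ?thesis
        unfolding eq
        using norm_triangle_ineq4[of "(p i - p j) + r i" "r j"] norm_triangle_ineq[of "p i - p j" "r i"]
          r[of i] r[of j] by linarith
    qed
    then have "real K * norm (T (d i - d j)) \<le>
        real K * (norm (p i - p j) + 1 / real (Suc i) + 1 / real (Suc j))"
      by (intro mult_left_mono) auto
    then show "norm (d i - d j) \<le>
        fst (f 0) * (norm (snd (f i) - snd (f j)) + 1 / real (Suc i) + 1 / real (Suc j))"
      using bd(2)[of "d i - d j"] by (simp add: f_def)
  qed
  moreover have "code_support (f i) \<subseteq> u" for i
    using supp p(3) by (force simp: code_support_def f_def)
  ultimately show ?thesis by blast
qed

text \<open>
  Along indices \<open>I y k\<close> for which \<open>d (I y k)\<close> tends to \<open>y\<close>, the vectors \<open>p (I y k)\<close> converge, and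
  their limit defines \<open>T y\<close>. The errors vanish in the limit of the conditions on a code.
\<close>

lemma code_imp_embeds:
  assumes d: "\<And>y \<epsilon> N. \<epsilon> > 0 \<Longrightarrow> \<exists>n\<ge>N. norm (d n - y) < \<epsilon>"
    and f: "f \<in> codes d P" and supp: "\<And>i. code_support (f i) \<subseteq> u"
  shows "embeds u"
proof -
  define K where "K = fst (f 0)"
  define p where "p i = snd (f i)" for i
  have up: "norm (scaleX a (p i) + scaleX b (p j) - p l) \<le>
      real K * norm (scaleY a (d i) + scaleY b (d j) - d l)
      + (norm a / real (Suc i) + norm b / real (Suc j) + 1 / real (Suc l))" for a b i j l
    using f unfolding codes_def K_def p_def by blast
  have low: "norm (d i - d j) \<le> real K * (norm (p i - p j) + 1 / real (Suc i) + 1 / real (Suc j))" for i j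
    using f unfolding codes_def K_def p_def by blast
  have "\<exists>n\<ge>k. norm (d n - y) < 1 / real (Suc k)" for y k
    using d[of "1 / real (Suc k)"] by simp
  then have "\<forall>y k. \<exists>n. n \<ge> k \<and> norm (d n - y) < 1 / real (Suc k)"
    by blast
  then obtain I where "\<forall>y k. I y k \<ge> k \<and> norm (d (I y k) - y) < 1 / real (Suc k)"
    unfolding choice_iff by blast
  then have I: "I y k \<ge> k" "norm (d (I y k) - y) < 1 / real (Suc k)" for y k
    by auto
  have null: "(\<lambda>k. 1 / real (Suc k)) \<longlonglongrightarrow> 0"
    using LIMSEQ_Suc[OF lim_1_over_n] by simp
  have tol_le: "1 / real (Suc (I y k)) \<le> 1 / real (Suc k)" for y k
    using I(1)[of k y] by (simp add: field_simps)
  have tol: "(\<lambda>k. c / real (Suc (I y k))) \<longlonglongrightarrow> 0" for c y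
  proof -
    have "(\<lambda>k. 1 / real (Suc (I y k))) \<longlonglongrightarrow> 0"
      using tol_le by (intro tendsto_sandwich[OF _ _ tendsto_const null]) auto
    from tendsto_mult_right_zero[OF this, of c] show ?thesis by simp
  qed
  have dI: "(\<lambda>k. d (I y k)) \<longlonglongrightarrow> y" for y
  proof -
    have "(\<lambda>k. d (I y k) - y) \<longlonglongrightarrow> 0"
      using I(2) by (intro Lim_null_comparison[OF _ null]) (auto intro!: always_eventually less_imp_le)
    then show ?thesis by (rule LIM_zero_cancel)
  qed
  have "Cauchy (\<lambda>k. p (I y k))" for y
  proof (rule metric_CauchyI)
    fix \<epsilon> :: real assume \<epsilon>: "\<epsilon> > 0"
    define C where "C = 2 * real K + 2"
    have "(\<lambda>k. C * (1 / real (Suc k))) \<longlonglongrightarrow> 0"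
      using null by (rule tendsto_mult_right_zero)
    then have "\<forall>\<^sub>F k in sequentially. C * (1 / real (Suc k)) < \<epsilon>"
      using \<epsilon> by (rule order_tendstoD(2))
    then obtain N where N: "C * (1 / real (Suc N)) < \<epsilon>"
      by (auto simp: eventually_sequentially)
    have "dist (p (I y m)) (p (I y n)) < \<epsilon>" if "m \<ge> N" "n \<ge> N" for m n
    proof -
      have t: "1 / real (Suc k) \<le> 1 / real (Suc N)" if "k \<ge> N" for k
        using that by (simp add: field_simps)
      have "norm (p (I y m) - p (I y n)) \<le>
          real K * norm (d (I y m) - d (I y n)) + (1 / real (Suc (I y m)) + 1 / real (Suc (I y n)))"
        using up[of 1 "I y m" 0 "I y m" "I y n"] by simp
      also have "\<dots> \<le> real K * (2 / real (Suc N)) + (1 / real (Suc N) + 1 / real (Suc N))"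
      proof (intro add_mono mult_left_mono)
        show "norm (d (I y m) - d (I y n)) \<le> 2 / real (Suc N)"
          using norm_triangle_ineq4[of "d (I y m) - y" "d (I y n) - y"] I(2)[of y m] I(2)[of y n]
            t[OF that(1)] t[OF that(2)] by simp
        show "1 / real (Suc (I y m)) \<le> 1 / real (Suc N)" "1 / real (Suc (I y n)) \<le> 1 / real (Suc N)"
          using tol_le t that order_trans by blast+
      qed simp
      also have "\<dots> = C * (1 / real (Suc N))" by (simp add: C_def add_divide_distrib)
      finally show ?thesis using N by (simp add: dist_norm)
    qed
    then show "\<exists>M. \<forall>m\<ge>M. \<forall>n\<ge>M. dist (p (I y m)) (p (I y n)) < \<epsilon>" by blast
  qed
  then have "\<exists>x. (\<lambda>k. p (I y k)) \<longlonglongrightarrow> x" for y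
    by (simp add: Cauchy_convergent_iff convergent_def)
  then obtain T where T: "\<And>y. (\<lambda>k. p (I y k)) \<longlonglongrightarrow> T y"
    by metis
  have T_up: "norm (scaleX a (T y) + scaleX b (T z) - T w) \<le> real K * norm (scaleY a y + scaleY b z - w)"
    for a b y z w
  proof (rule LIMSEQ_le)
    show "(\<lambda>k. norm (scaleX a (p (I y k)) + scaleX b (p (I z k)) - p (I w k))) \<longlonglongrightarrow>
        norm (scaleX a (T y) + scaleX b (T z) - T w)"
      by (intro tendsto_norm tendsto_diff tendsto_add tendsto_smul_right T)
    have "(\<lambda>k. real K * norm (scaleY a (d (I y k)) + scaleY b (d (I z k)) - d (I w k))
        + (norm a / real (Suc (I y k)) + norm b / real (Suc (I z k)) + 1 / real (Suc (I w k)))) \<longlonglongrightarrow>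
        real K * norm (scaleY a y + scaleY b z - w) + (0 + 0 + 0)"
      by (intro tendsto_mult_left tendsto_norm tendsto_diff tendsto_add Y.tendsto_smul_right dI tol)
    then show "(\<lambda>k. real K * norm (scaleY a (d (I y k)) + scaleY b (d (I z k)) - d (I w k))
        + (norm a / real (Suc (I y k)) + norm b / real (Suc (I z k)) + 1 / real (Suc (I w k)))) \<longlonglongrightarrow>
        real K * norm (scaleY a y + scaleY b z - w)"
      by simp
  qed (use up in blast)
  have T_low: "norm (y - z) \<le> real K * norm (T y - T z)" for y z
  proof (rule LIMSEQ_le)
    show "(\<lambda>k. norm (d (I y k) - d (I z k))) \<longlonglongrightarrow> norm (y - z)"
      by (intro tendsto_norm tendsto_diff dI)
    have "(\<lambda>k. real K * (norm (p (I y k) - p (I z k)) + 1 / real (Suc (I y k)) + 1 / real (Suc (I z k))))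
        \<longlonglongrightarrow> real K * (norm (T y - T z) + 0 + 0)"
      by (intro tendsto_mult_left tendsto_norm tendsto_diff tendsto_add T tol)
    then show "(\<lambda>k. real K * (norm (p (I y k) - p (I z k)) + 1 / real (Suc (I y k)) + 1 / real (Suc (I z k))))
        \<longlonglongrightarrow> real K * norm (T y - T z)"
      by simp
  qed (use low in blast)
  (* Choosing w as the combination of y and z makes the right-hand side of T_up vanish. *)
  have Tadd: "T (y + z) = T y + T z" for y z
    using T_up[of 1 y 1 z "y + z"] by simp
  have Tscale: "T (scaleY c y) = scaleX c (T y)" for c y
    using T_up[of c y 0 y "scaleY c y"] by simp
  have T0: "T 0 = 0" using Tadd[of 0 0] by simp
  have "coord (T y) n = 0" if "n \<notin> u" for y n
  proof -
    have "coord (p i) n = 0" for i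
      using supp[of i] that by (auto simp: code_support_def p_def)
    then show ?thesis
      using bounded_linear.tendsto[OF bounded_linear_coord T[of y], of n]
      by (simp add: LIMSEQ_const_iff)
  qed
  moreover have "norm (T y) \<le> real K * norm y" "norm y \<le> real K * norm (T y)" for y
    using T_up[of 1 y 0 y 0] T_low[of y 0] by (simp_all add: T0)
  moreover have "Vector_Spaces.linear scaleY scaleX T"
    unfolding linear_iff using Tadd Tscale by blast
  ultimately show ?thesis
    unfolding embeds_iff by blast
qed

theorem embeds_dichotomy:
  assumes "\<not> small {u. embeds u}"
  obtains J where "successive J" "\<And>I. infinite I \<Longrightarrow> embeds (\<Union>k\<in>I. J k)"
proof -
  have "{u. embeds u} \<noteq> {}" using assms by (auto simp: small_def)
  then obtain d :: "nat \<Rightarrow> 'b" where d: "\<And>y \<epsilon> N. \<epsilon> > 0 \<Longrightarrow> \<exists>n\<ge>N. norm (d n - y) < \<epsilon>"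
    using embeds_imp_separable by blast
  obtain P where P: "countable P"
    "\<And>x \<epsilon>. \<epsilon> > 0 \<Longrightarrow> \<exists>p\<in>P. norm (x - p) < \<epsilon> \<and> (\<forall>n. coord x n = 0 \<longrightarrow> coord p n = 0)"
    using countable_approximants by blast
  have E: "u \<in> cyl (codes d P) code_support [] \<longleftrightarrow> embeds u" for u
    using embeds_imp_code[OF P(2), of u d] code_imp_embeds[OF d, of _ P u] by (auto simp: cyl_def)
  have C: "countable ((UNIV :: nat set) \<times> P)" using P(1) by simp
  have fC: "f i \<in> UNIV \<times> P" if "f \<in> codes d P" for f i
    using that by (simp add: codes_def mem_Times_iff)
  have "persistent (codes d P) code_support ({}, [])"
    using assms small_embeds_tail_imp_small by (auto simp: persistent_def E)
  then obtain J where "successive J"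
    "\<And>I. infinite I \<Longrightarrow> (\<Union>k\<in>I. J k) \<in> cyl (codes d P) code_support []"
    using persistent_imp_successive[OF C, of "codes d P"] fC codes_closed[of d P] by blast
  then show ?thesis
    using that E by blast
qed

end

section \<open>The dichotomy\<close>

theorem theorem3p2:
  fixes scaleX :: "'k::{real_normed_field, euclidean_space} \<Rightarrow> 'a::banach \<Rightarrow> 'a"
    and scaleY :: "'k \<Rightarrow> 'b::banach \<Rightarrow> 'b"
    and e :: "nat \<Rightarrow> 'a"
  assumes X: "banach_space_over scaleX"
    and Y: "banach_space_over scaleY"
    and basis: "schauder_basis scaleX e"
  shows "(\<exists>I. successive I \<and>
            (\<forall>J. infinite J \<longrightarrow>
              \<not> embeds_isomorphically scaleY scaleX
                  (closed_span scaleX {e n |n. n \<notin> (\<Union>j\<in>J. I j)})))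
         \<longleftrightarrow> \<not> (\<exists>J. successive J \<and>
            (\<forall>I. infinite I \<longrightarrow>
              embeds_isomorphically scaleY scaleX
                  (closed_span scaleX {e n |n. n \<in> (\<Union>i\<in>I. J i)})))"
proof -
  interpret embedding_problem scaleX e scaleY
    using X Y basis by (intro embedding_problem.intro schauder_space.intro schauder_space_axioms.intro)
  have emb: "embeds_isomorphically scaleY scaleX (closed_span scaleX {e n |n. n \<in> u}) = embeds u" for u
    by (simp add: embeds_def image_def setcompr_eq_image)
  have embC: "embeds_isomorphically scaleY scaleX (closed_span scaleX {e n |n. n \<notin> u}) = embeds (- u)" for u
    using emb[of "- u"] by simp
  show ?thesis
    unfolding emb embC
  proof
    assume "\<exists>I. successive I \<and> (\<forall>J. infinite J \<longrightarrow> \<not> embeds (- (\<Union>j\<in>J. I j)))"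
    then obtain I where I: "successive I" "\<And>A. infinite A \<Longrightarrow> \<not> embeds (- (\<Union>k\<in>A. I k))"
      by blast
    show "\<not> (\<exists>J. successive J \<and> (\<forall>I. infinite I \<longrightarrow> embeds (\<Union>i\<in>I. J i)))"
    proof
      assume "\<exists>J. successive J \<and> (\<forall>I. infinite I \<longrightarrow> embeds (\<Union>i\<in>I. J i))"
      then obtain J where J: "successive J" "\<And>B. infinite B \<Longrightarrow> embeds (\<Union>k\<in>B. J k)"
        by blast
      obtain A B where AB: "infinite A" "infinite B" "(\<Union>k\<in>A. I k) \<inter> (\<Union>k\<in>B. J k) = {}"
        using successive_disjoint_subsequences[OF I(1) J(1)] .
      have "embeds (- (\<Union>k\<in>A. I k))"
        using J(2)[OF AB(2)] by (rule embeds_mono) (use AB(3) in blast)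
      with I(2)[OF AB(1)] show False by blast
    qed
  next
    assume no_J: "\<not> (\<exists>J. successive J \<and> (\<forall>I. infinite I \<longrightarrow> embeds (\<Union>i\<in>I. J i)))"
    have "small {u. embeds u}"
    proof (rule ccontr)
      assume "\<not> small {u. embeds u}"
      then show False by (rule embeds_dichotomy) (use no_J in blast)
    qed
    then obtain I where I: "successive I"
      "\<And>u. u \<in> {u. embeds u} \<Longrightarrow> \<forall>\<^sub>F k in sequentially. u \<inter> I k \<noteq> {}"
      using small_imp_successive by blast
    have "\<not> embeds (- (\<Union>j\<in>J. I j))" if "infinite J" for J
    proof
      assume "embeds (- (\<Union>j\<in>J. I j))"
      then obtain N where "\<And>k. k \<ge> N \<Longrightarrow> - (\<Union>j\<in>J. I j) \<inter> I k \<noteq> {}"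
        using I(2) unfolding eventually_sequentially by blast
      moreover obtain k where "k \<ge> N" "k \<in> J"
        using \<open>infinite J\<close> unfolding infinite_nat_iff_unbounded_le by blast
      ultimately show False by blast
    qed
    with I(1) show "\<exists>I. successive I \<and> (\<forall>J. infinite J \<longrightarrow> \<not> embeds (- (\<Union>j\<in>J. I j)))"
      by blast
  qed
qed

end
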